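(* The Steiner ratio and the Steiner--Gromov ratio of the Gromov--Hausdorff space $\mathcal{M}$ are both equal to $1/2$: $\mathrm{sr}(\mathcal{M})=1/2$ and $\mathrm{sgr}(\mathcal{M})=1/2$.
   Context: Gromov--Hausdorff space. For subsets $A,B$ of a metric space, $d_H(A,B)$ denotes the Hausdorff distance. The Gromov--Hausdorff distance $d_{GH}(X,Y)$ between metric spaces $X$ and $Y$ is the infimum of the real numbers $r$ for which there exist a metric space $Z$ and subsets $X',Y'\subset Z$ isometric to $X$ and $Y$ respectively with $d_H(X',Y')\le r$. $\mathcal{M}$ is the set of isometry classes of (nonempty) compact metric spaces endowed with the metric $d_{GH}$. Lengths of trees. Let $Z$ be a metric space, with $|xy|$ the distance between $x,y\in Z$. A graph $G=(V,E)$ is defined on $Z$ if $V\subset Z$; the length of an edge $vw$ is $|vw|$, and the length $|G|$ of $G$ is the sum of the lengths of all its edges. $G$ connects a finite nonempty subset $M\subset Z$ if $M\subset V$. $\mathrm{smt}(M,Z)$ is the infimum of $|G|$ over all connected graphs $G$ on $Z$ connecting $M$. For a finite metric space $M$, $\mathrm{mst}(M)$ is the smallest length of a tree of the form $(M,E)$, i.e. with vertex set exactly $M$ (the length of a minimal spanning tree). For a finite metric space $M$, $\mathrm{mf}(M)$ (the length of a minimal filling) is the infimum of the real numbers $r$ for which there exist a metric space $Z$ and an isometric (distance-preserving) embedding $\mu\colon M\to Z$ with $\mathrm{smt}(\mu(M),Z)\le r$. Ratios. For a finite subset $M$ of a metric space $Z$ with at least two points, put $\mathrm{sr}(M,Z)=\mathrm{smt}(M,Z)/\mathrm{mst}(M)$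 and $\mathrm{sgr}(M)=\mathrm{mf}(M)/\mathrm{mst}(M)$. The Steiner ratio of $Z$ is $\mathrm{sr}(Z)=\inf_M \mathrm{sr}(M,Z)$ and the Steiner--Gromov ratio of $Z$ is $\mathrm{sgr}(Z)=\inf_M\mathrm{sgr}(M)$, the infima being taken over all finite $M\subset Z$ consisting of at least two points. *)

theory Defs
  imports "HOL-Analysis.Analysis"
begin

section \<open>Lengths of graphs in a metric space\<close>

text \<open>
  A metric space is given either as a value of type \<^typ>\<open>'a metric\<close> or as a carrier \<open>Z\<close>
  with a distance function \<open>d\<close> such that \<^prop>\<open>Metric_space Z d\<close>. Graphs are finite, simple and
  undirected; edges are two-element sets of vertices.
\<close>

definition simple_graph :: "'a set \<Rightarrow> 'a set set \<Rightarrow> bool" where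
  "simple_graph V E \<longleftrightarrow> finite V \<and> (\<forall>e\<in>E. e \<subseteq> V \<and> card e = 2)"

definition connected_graph :: "'a set \<Rightarrow> 'a set set \<Rightarrow> bool" where
  "connected_graph V E \<longleftrightarrow> simple_graph V E \<and>
     (\<forall>v\<in>V. \<forall>w\<in>V. (v, w) \<in> {(x, y). {x, y} \<in> E}\<^sup>*)"

definition graph_cycle :: "'a set set \<Rightarrow> 'a list \<Rightarrow> bool" where
  "graph_cycle E c \<longleftrightarrow> length c \<ge> 3 \<and> distinct c \<and>
     (\<forall>i. Suc i < length c \<longrightarrow> {c ! i, c ! Suc i} \<in> E) \<and> {last c, hd c} \<in> E"

definition tree_graph :: "'a set \<Rightarrow> 'a set set \<Rightarrow> bool" where
  "tree_graph V E \<longleftrightarrow> connected_graph V E \<and> \<not> (\<exists>c. graph_cycle E c)"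

definition edge_length :: "('a \<Rightarrow> 'a \<Rightarrow> real) \<Rightarrow> 'a set \<Rightarrow> real" where
  "edge_length d e = (THE l. \<exists>v w. e = {v, w} \<and> l = d v w)"

lemma edge_length_pair:
  assumes "\<And>x y. d x y = d y x"
  shows "edge_length d {v, w} = d v w"
  unfolding edge_length_def using assms by (auto simp: doubleton_eq_iff)

definition graph_length :: "('a \<Rightarrow> 'a \<Rightarrow> real) \<Rightarrow> 'a set set \<Rightarrow> real" where
  "graph_length d E = (\<Sum>e\<in>E. edge_length d e)"

definition smt :: "'a set \<Rightarrow> ('a \<Rightarrow> 'a \<Rightarrow> real) \<Rightarrow> 'a set \<Rightarrow> real" where
  "smt Z d M = Inf {graph_length d E | V E. connected_graph V E \<and> V \<subseteq> Z \<and> M \<subseteq> V}"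

definition mst :: "('a \<Rightarrow> 'a \<Rightarrow> real) \<Rightarrow> 'a set \<Rightarrow> real" where
  "mst d M = Min {graph_length d E | E. tree_graph M E}"

text \<open>
  The metric spaces \<open>Z\<close> containing an isometric copy of \<open>M\<close> range over those with points in
  \<^typ>\<open>real\<close>; by \<open>mf_le\<close> below, spaces over any other type do not lower the infimum.
\<close>

definition mf :: "('a \<Rightarrow> 'a \<Rightarrow> real) \<Rightarrow> 'a set \<Rightarrow> real" where
  "mf d M = Inf {r. \<exists>(Z :: real metric) \<mu>.
     \<mu> ` M \<subseteq> mspace Z \<and> (\<forall>x\<in>M. \<forall>y\<in>M. mdist Z (\<mu> x) (\<mu> y) = d x y) \<and>
     smt (mspace Z) (mdist Z) (\<mu> ` M) \<le> r}"

definition steiner_ratio :: "'a set \<Rightarrow> ('a \<Rightarrow> 'a \<Rightarrow> real) \<Rightarrow> real" where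
  "steiner_ratio Z d =
     Inf {smt Z d M / mst d M | M. finite M \<and> M \<subseteq> Z \<and> card M \<ge> 2}"

definition steiner_gromov_ratio :: "'a set \<Rightarrow> ('a \<Rightarrow> 'a \<Rightarrow> real) \<Rightarrow> real" where
  "steiner_gromov_ratio Z d =
     Inf {mf d M / mst d M | M. finite M \<and> M \<subseteq> Z \<and> card M \<ge> 2}"


section \<open>The Gromov--Hausdorff space\<close>

text \<open>
  The value is the usual one for nonempty bounded sets, the only case in which it is used.
\<close>

definition hausdorff_distance :: "('a \<Rightarrow> 'a \<Rightarrow> real) \<Rightarrow> 'a set \<Rightarrow> 'a set \<Rightarrow> real" where
  "hausdorff_distance d A B =
     Inf {r. r > 0 \<and> (\<forall>a\<in>A. \<exists>b\<in>B. d a b < r) \<and> (\<forall>b\<in>B. \<exists>a\<in>A. d a b < r)}"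

definition isometric_spaces :: "'a metric \<Rightarrow> 'b metric \<Rightarrow> bool" where
  "isometric_spaces X Y \<longleftrightarrow> (\<exists>f. bij_betw f (mspace X) (mspace Y) \<and>
     (\<forall>x\<in>mspace X. \<forall>y\<in>mspace X. mdist Y (f x) (f y) = mdist X x y))"

text \<open>
  Again \<^typ>\<open>real\<close> is a large enough universe of points: every compact metric space is isometric
  to one in \<^typ>\<open>real metric\<close> (\<open>compact_metric_real\<close>), and spaces \<open>Z\<close> over other types do not
  lower the infimum defining the Gromov--Hausdorff distance of such spaces
  (\<open>gromov_hausdorff_real\<close>).
\<close>

definition gromov_hausdorff :: "real metric \<Rightarrow> real metric \<Rightarrow> real" where
  "gromov_hausdorff X Y = Inf {r. \<exists>(Z :: real metric) X' Y'.
     X' \<subseteq> mspace Z \<and> Y' \<subseteq> mspace Z \<and>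
     isometric_spaces X (submetric Z X') \<and> isometric_spaces Y (submetric Z Y') \<and>
     hausdorff_distance (mdist Z) X' Y' \<le> r}"

definition compact_metrics :: "real metric set" where
  "compact_metrics = {X. mspace X \<noteq> {} \<and> compact_space (mtopology_of X)}"

definition GH_space :: "real metric set set" where
  "GH_space = compact_metrics //
     {(X, Y). X \<in> compact_metrics \<and> Y \<in> compact_metrics \<and> isometric_spaces X Y}"

definition GH_dist :: "real metric set \<Rightarrow> real metric set \<Rightarrow> real" where
  "GH_dist A B = gromov_hausdorff (SOME X. X \<in> A) (SOME Y. Y \<in> B)"


section \<open>Isometry classes and the choice of the universe\<close>

lemma isometric_spaces_refl: "isometric_spaces X X"
  unfolding isometric_spaces_def by (rule exI[of _ id]) auto

lemma isometric_spaces_sym: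
  assumes "isometric_spaces X Y" shows "isometric_spaces Y X"
proof -
  obtain f where f: "bij_betw f (mspace X) (mspace Y)"
    and d: "\<And>x y. x \<in> mspace X \<Longrightarrow> y \<in> mspace X \<Longrightarrow> mdist Y (f x) (f y) = mdist X x y"
    using assms unfolding isometric_spaces_def by blast
  let ?g = "inv_into (mspace X) f"
  have g: "bij_betw ?g (mspace Y) (mspace X)"
    by (rule bij_betw_inv_into[OF f])
  have "mdist X (?g u) (?g v) = mdist Y u v" if "u \<in> mspace Y" "v \<in> mspace Y" for u v
    using d[of "?g u" "?g v"] that bij_betw_inv_into_right[OF f] bij_betwE[OF g] by simp
  with g show ?thesis unfolding isometric_spaces_def by blast
qed

lemma isometric_spaces_trans:
  assumes "isometric_spaces X Y" "isometric_spaces Y W" shows "isometric_spaces X W"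
proof -
  obtain f where f: "bij_betw f (mspace X) (mspace Y)"
    and df: "\<And>x y. x \<in> mspace X \<Longrightarrow> y \<in> mspace X \<Longrightarrow> mdist Y (f x) (f y) = mdist X x y"
    using assms(1) unfolding isometric_spaces_def by blast
  obtain g where g: "bij_betw g (mspace Y) (mspace W)"
    and dg: "\<And>x y. x \<in> mspace Y \<Longrightarrow> y \<in> mspace Y \<Longrightarrow> mdist W (g x) (g y) = mdist Y x y"
    using assms(2) unfolding isometric_spaces_def by blast
  show ?thesis unfolding isometric_spaces_def
    using bij_betw_trans[OF f g] df dg bij_betwE[OF f]
    by (intro exI[of _ "g \<circ> f"]) auto
qed

lemma equiv_isometric:
  "equiv compact_metrics
     {(X, Y). X \<in> compact_metrics \<and> Y \<in> compact_metrics \<and> isometric_spaces X Y}"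
  by (rule equivI)
     (auto simp: refl_on_def sym_def trans_def intro: isometric_spaces_refl isometric_spaces_sym
       isometric_spaces_trans)

lemma gromov_hausdorff_cong:
  assumes "isometric_spaces X X1" "isometric_spaces Y Y1"
  shows "gromov_hausdorff X Y = gromov_hausdorff X1 Y1"
proof -
  have "isometric_spaces X W \<longleftrightarrow> isometric_spaces X1 W" for W :: "real metric"
    using assms(1) isometric_spaces_sym isometric_spaces_trans by blast
  moreover have "isometric_spaces Y W \<longleftrightarrow> isometric_spaces Y1 W" for W :: "real metric"
    using assms(2) isometric_spaces_sym isometric_spaces_trans by blast
  ultimately show ?thesis unfolding gromov_hausdorff_def by simp
qed

lemma GH_dist_eq:
  assumes "A \<in> GH_space" "B \<in> GH_space" "X \<in> A" "Y \<in> B"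
  shows "GH_dist A B = gromov_hausdorff X Y"
proof -
  have "isometric_spaces (SOME X. X \<in> C) W" if "C \<in> GH_space" "W \<in> C" for C W
  proof -
    have "(SOME X. X \<in> C) \<in> C" using that(2) by (rule someI)
    then show ?thesis
      using quotient_eq_iff[OF equiv_isometric, of C C "SOME X. X \<in> C" W] that
      unfolding GH_space_def by auto
  qed
  then show ?thesis unfolding GH_dist_def using assms by (blast intro: gromov_hausdorff_cong)
qed

lemma metric_transport:
  fixes m :: "'a metric" and f :: "'a \<Rightarrow> 'b"
  assumes "inj_on f (mspace m)"
  obtains m' :: "'b metric" where "mspace m' = f ` mspace m"
    and "\<And>x y. x \<in> mspace m \<Longrightarrow> y \<in> mspace m \<Longrightarrow> mdist m' (f x) (f y) = mdist m x y"
proof -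
  let ?g = "inv_into (mspace m) f"
  let ?d = "\<lambda>u v. mdist m (?g u) (?g v)"
  have M: "Metric_space (f ` mspace m) ?d"
    using assms by unfold_locales (auto simp: mdist_commute mdist_triangle inj_on_eq_iff)
  show thesis
  proof (rule that[of "metric (f ` mspace m, ?d)"])
    show "mspace (metric (f ` mspace m, ?d)) = f ` mspace m"
      by (rule Metric_space.mspace_metric[OF M])
    show "mdist (metric (f ` mspace m, ?d)) (f x) (f y) = mdist m x y"
      if "x \<in> mspace m" "y \<in> mspace m" for x y
      using that assms by (simp add: Metric_space.mdist_metric[OF M])
  qed
qed

lemma compact_metric_real:
  fixes m :: "'a metric"
  assumes "compact_space (mtopology_of m)"
  shows "\<exists>m' :: real metric. compact_space (mtopology_of m') \<and> isometric_spaces m m'"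
proof -
  interpret m: Metric_space "mspace m" "mdist m" by simp
  have tb: "m.mtotally_bounded (mspace m)"
    using assms m.compact_space_eq_mcomplete_mtotally_bounded by (simp add: mtopology_of_def)
  have "\<exists>K. finite K \<and> K \<subseteq> mspace m \<and> mspace m \<subseteq> (\<Union>x\<in>K. m.mball x (1 / Suc n))" for n :: nat
    using tb unfolding m.mtotally_bounded_def by simp
  then obtain K where K: "\<And>n :: nat. finite (K n)" "\<And>n. K n \<subseteq> mspace m"
      "\<And>n. mspace m \<subseteq> (\<Union>x\<in>K n. m.mball x (1 / Suc n))"
    by metis
  define D where "D = (\<Union>n. K n)"
  have D: "countable D" unfolding D_def using K(1) by (simp add: countable_finite)
  define S where "S x = {prod_encode (to_nat_on D k, n) | k n. k \<in> D \<and> mdist m k x < 1 / Suc n}"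
    for x
  have injS: "inj_on S (mspace m)"
  proof (rule inj_onI, rule ccontr)
    fix x y assume xy: "x \<in> mspace m" "y \<in> mspace m" "S x = S y" "x \<noteq> y"
    then have "mdist m x y / 2 > 0" by (simp add: order_less_le)
    then obtain n where n: "1 / real (Suc n) < mdist m x y / 2"
      using nat_approx_posE by blast
    obtain k where k: "k \<in> K n" "mdist m k x < 1 / Suc n"
      using K(3)[of n] xy(1) by auto
    have kD: "k \<in> D" using k(1) D_def by auto
    have "prod_encode (to_nat_on D k, n) \<in> S x" unfolding S_def using k kD by blast
    then have "prod_encode (to_nat_on D k, n) \<in> S y" using xy(3) by simp
    then have "mdist m k y < 1 / Suc n"
      unfolding S_def using D kD by auto
    moreover have "mdist m x y \<le> mdist m k x + mdist m k y"
      using mdist_triangle[of x m k y] xy k(1) K(2) by (auto simp: mdist_commute[of m x k])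
    ultimately show False using k(2) n by linarith
  qed
  obtain g :: "nat set \<Rightarrow> real" where g: "inj g"
    using nat_sets_eqpoll_reals unfolding eqpoll_def bij_betw_def by blast
  define f where "f = g \<circ> S"
  have f: "inj_on f (mspace m)"
    unfolding f_def using injS g by (meson comp_inj_on inj_on_subset subset_UNIV)
  obtain m' :: "real metric" where m': "mspace m' = f ` mspace m"
    and d: "\<And>x y. x \<in> mspace m \<Longrightarrow> y \<in> mspace m \<Longrightarrow> mdist m' (f x) (f y) = mdist m x y"
    using metric_transport[OF f] by blast
  interpret Metric_space12 "mspace m" "mdist m" "mspace m'" "mdist m'"
    by (simp add: Metric_space12_def)
  have "homeomorphic_map (mtopology_of m) (mtopology_of m') f"
    unfolding mtopology_of_def using isometry_imp_homeomorphic_map[of f] m' d by auto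
  then have "compact_space (mtopology_of m')"
    using assms
    by (metis homeomorphic_compact_space homeomorphic_map_imp_homeomorphic_space)
  moreover have "isometric_spaces m m'"
    unfolding isometric_spaces_def using f m' d by (auto simp: bij_betw_def)
  ultimately show ?thesis by blast
qed

lemma gromov_hausdorff_real:
  fixes X Y :: "real metric" and Z :: "'c metric"
  assumes sub: "X' \<subseteq> mspace Z" "Y' \<subseteq> mspace Z"
    and iso: "isometric_spaces X (submetric Z X')" "isometric_spaces Y (submetric Z Y')"
    and le: "hausdorff_distance (mdist Z) X' Y' \<le> r"
  shows "\<exists>(Z1 :: real metric) X1 Y1. X1 \<subseteq> mspace Z1 \<and> Y1 \<subseteq> mspace Z1 \<and>
     isometric_spaces X (submetric Z1 X1) \<and> isometric_spaces Y (submetric Z1 Y1) \<and>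
     hausdorff_distance (mdist Z1) X1 Y1 \<le> r"
proof -
  have "\<exists>g :: 'c \<Rightarrow> real. inj_on g A" if "A \<subseteq> mspace Z" "isometric_spaces W (submetric Z A)"
    for A and W :: "real metric"
    using isometric_spaces_sym[OF that(2)] that(1)
    unfolding isometric_spaces_def bij_betw_def by (auto simp: Int_absorb2)
  then obtain g1 g2 :: "'c \<Rightarrow> real" where g: "inj_on g1 X'" "inj_on g2 Y'"
    using sub iso by meson
  define h where "h z = (if z \<in> X' then arctan (g1 z) else arctan (g2 z) + 4)" for z
  have ne: "arctan a \<noteq> arctan b + 4" for a b :: real
    using arctan_bounded[of a] arctan_bounded[of b] pi_less_4 by linarith
  have h: "inj_on h (X' \<union> Y')"
    using g ne ne[symmetric] by (auto simp: inj_on_def h_def arctan_eq_iff split: if_splits)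
  have W: "mspace (submetric Z (X' \<union> Y')) = X' \<union> Y'" using sub by auto
  obtain Z1 :: "real metric" where Z1: "mspace Z1 = h ` (X' \<union> Y')"
    and d: "\<And>x y. x \<in> X' \<union> Y' \<Longrightarrow> y \<in> X' \<union> Y' \<Longrightarrow> mdist Z1 (h x) (h y) = mdist Z x y"
    using metric_transport[of h "submetric Z (X' \<union> Y')"] h unfolding W mdist_submetric by blast
  have copy: "isometric_spaces (submetric Z A) (submetric Z1 (h ` A))" if "A \<subseteq> X' \<union> Y'" for A
  proof -
    have "A \<subseteq> mspace Z" "h ` A \<subseteq> mspace Z1" using that sub Z1 by auto
    then have "mspace (submetric Z A) = A" "mspace (submetric Z1 (h ` A)) = h ` A" by auto
    moreover have "bij_betw h A (h ` A)"
      using inj_on_subset[OF h that] by (simp add: bij_betw_def)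
    ultimately show ?thesis
      unfolding isometric_spaces_def using d that
      by (intro exI[of _ h]) (simp add: subset_iff)
  qed
  have "hausdorff_distance (mdist Z1) (h ` X') (h ` Y') = hausdorff_distance (mdist Z) X' Y'"
    unfolding hausdorff_distance_def using d by simp
  moreover have "isometric_spaces X (submetric Z1 (h ` X'))" "isometric_spaces Y (submetric Z1 (h ` Y'))"
    using iso copy isometric_spaces_trans by (meson Un_upper1 Un_upper2)+
  moreover have "h ` X' \<subseteq> mspace Z1" "h ` Y' \<subseteq> mspace Z1" using Z1 by auto
  ultimately show ?thesis using le by (metis (no_types, lifting))
qed

lemma graph_length_nonneg:
  assumes "connected_graph V E" "\<And>x y. d x y \<ge> 0" "\<And>x y. d x y = d y x"
  shows "graph_length d E \<ge> 0"
  unfolding graph_length_def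
proof (rule sum_nonneg)
  fix e assume "e \<in> E"
  then have "card e = 2" using assms(1) by (simp add: connected_graph_def simple_graph_def)
  then show "edge_length d e \<ge> 0" using assms(2,3) edge_length_pair by (metis card_2_iff)
qed

lemma smt_le:
  assumes "connected_graph V E" "V \<subseteq> mspace Z" "M \<subseteq> V"
  shows "smt (mspace Z) (mdist Z) M \<le> graph_length (mdist Z) E"
  unfolding smt_def
proof (rule cInf_lower)
  show "bdd_below {graph_length (mdist Z) E | V E. connected_graph V E \<and> V \<subseteq> mspace Z \<and> M \<subseteq> V}"
    using graph_length_nonneg[of _ _ "mdist Z"] by (force intro: bdd_belowI[of _ 0] simp: mdist_commute)
qed (use assms in blast)

lemma connected_graph_complete:
  assumes "finite M" shows "connected_graph M {e. e \<subseteq> M \<and> card e = 2}"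
proof -
  have "(v, w) \<in> {(x, y). {x, y} \<in> {e. e \<subseteq> M \<and> card e = 2}}\<^sup>*" if "v \<in> M" "w \<in> M" for v w
    using that by (cases "v = w") (auto intro!: r_into_rtrancl)
  then show ?thesis using assms by (simp add: connected_graph_def simple_graph_def)
qed

lemma connected_graph_image:
  assumes "connected_graph V E" "inj_on h V"
  shows "connected_graph (h ` V) ((`) h ` E)"
proof -
  have sg: "finite V" "\<And>e. e \<in> E \<Longrightarrow> e \<subseteq> V" "\<And>e. e \<in> E \<Longrightarrow> card e = 2"
    using assms(1) by (auto simp: connected_graph_def simple_graph_def)
  have "(h v, h w) \<in> {(x, y). {x, y} \<in> (`) h ` E}\<^sup>*" if "(v, w) \<in> {(x, y). {x, y} \<in> E}\<^sup>*" for v w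
    using that
  proof (induction rule: rtrancl_induct)
    case (step y z)
    then have "(h y, h z) \<in> {(x, y). {x, y} \<in> (`) h ` E}"
      using imageI[of "{y, z}" E "(`) h"] by simp
    with step.IH show ?case by (rule rtrancl_into_rtrancl)
  qed simp
  moreover have "card (h ` e) = 2" if "e \<in> E" for e
    using card_image[OF inj_on_subset[OF assms(2) sg(2)[OF that]]] sg(3)[OF that] by simp
  moreover have "h ` e \<subseteq> h ` V" if "e \<in> E" for e using sg(2)[OF that] by blast
  ultimately show ?thesis
    using assms(1) sg(1) unfolding connected_graph_def simple_graph_def by auto
qed

lemma graph_length_image:
  assumes "connected_graph V E" "inj_on h V"
    and "\<And>x y. d x y = d y x" "\<And>x y. d' x y = d' y x"
    and "\<And>x y. x \<in> V \<Longrightarrow> y \<in> V \<Longrightarrow> d' (h x) (h y) = d x y"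
  shows "graph_length d' ((`) h ` E) = graph_length d E"
proof -
  have sg: "\<And>e. e \<in> E \<Longrightarrow> e \<subseteq> V" "\<And>e. e \<in> E \<Longrightarrow> card e = 2"
    using assms(1) by (auto simp: connected_graph_def simple_graph_def)
  have "inj_on ((`) h) E"
    using inj_on_subset[OF inj_on_image_Pow[OF assms(2)]] sg(1) by (meson Pow_iff subsetI)
  moreover have "edge_length d' (h ` e) = edge_length d e" if "e \<in> E" for e
  proof -
    obtain v w where "e = {v, w}" using sg(2) \<open>e \<in> E\<close> by (meson card_2_iff)
    moreover from this have "v \<in> V" "w \<in> V" using sg(1) \<open>e \<in> E\<close> by auto
    ultimately show ?thesis
      using assms(5) edge_length_pair[of d, OF assms(3)]
        edge_length_pair[of d', OF assms(4)] by simp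
  qed
  ultimately show ?thesis unfolding graph_length_def by (simp add: sum.reindex)
qed

lemma mf_le:
  fixes Z :: "'c metric" and \<mu> :: "'a \<Rightarrow> 'c"
  assumes M: "finite M" "M \<noteq> {}" "\<mu> ` M \<subseteq> mspace Z"
    and iso: "\<And>x y. x \<in> M \<Longrightarrow> y \<in> M \<Longrightarrow> mdist Z (\<mu> x) (\<mu> y) = d x y"
  shows "mf d M \<le> smt (mspace Z) (mdist Z) (\<mu> ` M)"
  unfolding smt_def[of "mspace Z"]
proof (rule cInf_greatest)
  show "{graph_length (mdist Z) E | V E. connected_graph V E \<and> V \<subseteq> mspace Z \<and> \<mu> ` M \<subseteq> V} \<noteq> {}"
    using connected_graph_complete[of "\<mu> ` M"] M by blast
next
  fix l assume "l \<in> {graph_length (mdist Z) E | V E. connected_graph V E \<and> V \<subseteq> mspace Z \<and> \<mu> ` M \<subseteq> V}"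
  then obtain V E where G: "connected_graph V E" "V \<subseteq> mspace Z" "\<mu> ` M \<subseteq> V"
    and l: "l = graph_length (mdist Z) E" by blast
  have "finite V" using G(1) by (simp add: connected_graph_def simple_graph_def)
  define h :: "'c \<Rightarrow> real" where "h v = real (to_nat_on V v)" for v
  have h: "inj_on h V"
    using inj_on_to_nat_on[of V] \<open>finite V\<close> by (simp add: countable_finite h_def inj_on_def)
  have V: "mspace (submetric Z V) = V" using G(2) by auto
  obtain Z1 :: "real metric" where Z1: "mspace Z1 = h ` V"
    and d1: "\<And>x y. x \<in> V \<Longrightarrow> y \<in> V \<Longrightarrow> mdist Z1 (h x) (h y) = mdist Z x y"
    using metric_transport[of h "submetric Z V"] h unfolding V mdist_submetric by blast
  have "smt (mspace Z1) (mdist Z1) ((h \<circ> \<mu>) ` M) \<le> graph_length (mdist Z1) ((`) h ` E)"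
    by (rule smt_le[OF connected_graph_image[OF G(1) h]]) (use Z1 G(3) in auto)
  also have "\<dots> = l"
    unfolding l by (rule graph_length_image[OF G(1) h]) (auto simp: mdist_commute d1)
  finally have le: "smt (mspace Z1) (mdist Z1) ((h \<circ> \<mu>) ` M) \<le> l" .
  have nonneg: "smt (mspace W) (mdist W) (\<nu> ` M) \<ge> 0" if "\<nu> ` M \<subseteq> mspace W"
    for W :: "real metric" and \<nu>
    unfolding smt_def
  proof (rule cInf_greatest)
    show "{graph_length (mdist W) E | V E. connected_graph V E \<and> V \<subseteq> mspace W \<and> \<nu> ` M \<subseteq> V} \<noteq> {}"
      using connected_graph_complete[of "\<nu> ` M"] M(1) that by blast
  next
    fix k assume "k \<in> {graph_length (mdist W) E | V E. connected_graph V E \<and> V \<subseteq> mspace W \<and> \<nu> ` M \<subseteq> V}"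
    then obtain V E where "connected_graph V E" "k = graph_length (mdist W) E" by blast
    then show "0 \<le> k"
      using graph_length_nonneg[of V E "mdist W"] mdist_nonneg[of W] mdist_commute[of W] by blast
  qed
  show "mf d M \<le> l"
    unfolding mf_def
  proof (rule cInf_lower)
    have "(h \<circ> \<mu>) ` M \<subseteq> mspace Z1" using Z1 G(3) by auto
    moreover have "\<forall>x\<in>M. \<forall>y\<in>M. mdist Z1 ((h \<circ> \<mu>) x) ((h \<circ> \<mu>) y) = d x y"
      using d1 G(3) iso by (simp add: image_subset_iff)
    ultimately show "l \<in> {r. \<exists>(Z :: real metric) \<mu>. \<mu> ` M \<subseteq> mspace Z \<and>
        (\<forall>x\<in>M. \<forall>y\<in>M. mdist Z (\<mu> x) (\<mu> y) = d x y) \<and> smt (mspace Z) (mdist Z) (\<mu> ` M) \<le> r}"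
      using le by blast
  next
    show "bdd_below {r. \<exists>(Z :: real metric) \<mu>. \<mu> ` M \<subseteq> mspace Z \<and>
        (\<forall>x\<in>M. \<forall>y\<in>M. mdist Z (\<mu> x) (\<mu> y) = d x y) \<and> smt (mspace Z) (mdist Z) (\<mu> ` M) \<le> r}"
      by (rule bdd_belowI[of _ 0]) (use nonneg order_trans in blast)
  qed
qed

end

theory Submission
  imports Defs
begin

text \<open>
  In any metric space a connected graph through \<open>M\<close> carries a closed walk of at most twice its
  length, and short-cutting that walk to \<open>M\<close> gives a connected graph on \<open>M\<close>; hence
  \<open>mst M \<le> 2 smt M\<close>, and applying this in all ambient spaces also \<open>mst M \<le> 2 mf M\<close>. Equality is
  approached by \<open>n\<close> points at mutual distance at least \<open>1\<close> and at distance at most \<open>1 / 2\<close> from a common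
  centre, as \<open>smt M / mst M \<le> (n / 2) / (n - 1)\<close>. In the Gromov--Hausdorff space such a configuration
  consists of perturbations of a finite ultrametric space with well separated distances, the
  \<open>j\<close>-th of which increases the \<open>j\<close>-th distance by \<open>1\<close> and decreases all the others by \<open>1\<close>.
\<close>

section \<open>Dependence on the distance\<close>

text \<open>The doubling estimate rests on the metric axioms, so the Gromov--Hausdorff distance must
  first be shown to be a metric on isometry classes. Its definition as an infimum over ambient
  spaces is awkward for this; correspondences replace it. A correspondence of distortion at most
  \<open>2 * s\<close> with \<open>s > 0\<close> gives distance at most \<open>s\<close>, and
  distance below \<open>s\<close> gives such a correspondence. Correspondences compose without any
  ambient space, and they turn a lower bound on the distance into a comparison of the distances that
  occur in two finite spaces.

  This also explains the opposite signs of the perturbations. Each moves every distance by 1, so it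
  lies within 1/2 of the centre. Seen from another perturbation the raised distance has moved by 2,
  so no correspondence with \<open>s < 1\<close> can match it. The separation 1 is thus exactly
  twice the radius, the extremal case for a star. A compact space need not stop at finitely many
  points, but every finite \<open>n\<close> has such a family, and the ratios tend to 1/2.\<close>

lemma edge_length_cong:
  assumes "\<And>x y. x \<in> Z \<Longrightarrow> y \<in> Z \<Longrightarrow> d x y = d' x y" "e \<subseteq> Z"
  shows "edge_length d e = edge_length d' e"
proof -
  \<comment> \<open>Symmetry of the distances is not among the assumptions, so the description in
    \<open>edge_length\<close> may fail to be unique; equality of the two predicates settles that
    case as well.\<close>
  have "(\<exists>v w. e = {v, w} \<and> l = d v w) \<longleftrightarrow> (\<exists>v w. e = {v, w} \<and> l = d' v w)" for l
    using assms by (metis insert_subset)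
  then show ?thesis unfolding edge_length_def by simp
qed

lemma graph_length_cong:
  assumes "\<And>x y. x \<in> Z \<Longrightarrow> y \<in> Z \<Longrightarrow> d x y = d' x y" "connected_graph V E" "V \<subseteq> Z"
  shows "graph_length d E = graph_length d' E"
  unfolding graph_length_def
proof (rule sum.cong)
  fix e assume "e \<in> E"
  with assms(2,3) have "e \<subseteq> Z" by (auto simp: connected_graph_def simple_graph_def)
  with assms(1) show "edge_length d e = edge_length d' e" by (rule edge_length_cong)
qed simp

lemma smt_cong:
  assumes "\<And>x y. x \<in> Z \<Longrightarrow> y \<in> Z \<Longrightarrow> d x y = d' x y"
  shows "smt Z d M = smt Z d' M"
  unfolding smt_def using graph_length_cong[of Z d d', OF assms]
  by (intro arg_cong[where f = Inf] Collect_cong ex_cong1) auto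

lemma mst_cong:
  assumes "\<And>x y. x \<in> M \<Longrightarrow> y \<in> M \<Longrightarrow> d x y = d' x y"
  shows "mst d M = mst d' M"
  unfolding mst_def tree_graph_def using graph_length_cong[of M d d', OF assms _ subset_refl]
  by (intro arg_cong[where f = Min] Collect_cong ex_cong1) auto

lemma mf_cong:
  assumes "\<And>x y. x \<in> M \<Longrightarrow> y \<in> M \<Longrightarrow> d x y = d' x y"
  shows "mf d M = mf d' M"
  unfolding mf_def using assms by simp

text \<open>\<open>GH_dist\<close> is under control only on pairs of isometry classes, while the
  distance of a value of type \<open>metric\<close> is nonnegative and symmetric on the whole type.
  This lemma lets the final proof exchange one for the other.\<close>

lemma steiner_ratio_cong:
  assumes "\<And>x y. x \<in> Z \<Longrightarrow> y \<in> Z \<Longrightarrow> d x y = d' x y"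
  shows "steiner_ratio Z d = steiner_ratio Z d'"
proof -
  have "smt Z d M / mst d M = smt Z d' M / mst d' M" if "M \<subseteq> Z" for M
    using smt_cong[of Z d d', OF assms] mst_cong[of M d d', OF assms] that by (simp add: subset_iff)
  then show ?thesis 
    unfolding steiner_ratio_def by (intro arg_cong[where f = Inf] Collect_cong ex_cong1) auto
qed

lemma steiner_gromov_ratio_cong:
  assumes "\<And>x y. x \<in> Z \<Longrightarrow> y \<in> Z \<Longrightarrow> d x y = d' x y"
  shows "steiner_gromov_ratio Z d = steiner_gromov_ratio Z d'"
proof -
  have "mf d M / mst d M = mf d' M / mst d' M" if "M \<subseteq> Z" for M
    using mf_cong[of M d d', OF assms] mst_cong[of M d d', OF assms] that by (simp add: subset_iff)
  then show ?thesis
    unfolding steiner_gromov_ratio_def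
    by (intro arg_cong[where f = Inf] Collect_cong ex_cong1) auto
qed

section \<open>Connected subgraphs and spanning trees\<close>

text \<open>A path from inside \<open>S\<close> to outside must leave \<open>S\<close> at some edge.
  The induction along the path carries the alternative "still inside, or some edge has
  left".\<close>

lemma crossing_edge:
  assumes "connected_graph V E" "S \<subseteq> V" "S \<noteq> {}" "S \<noteq> V"
  obtains x y where "x \<in> S" "y \<in> V - S" "{x, y} \<in> E"
proof -
  obtain v w where vw: "v \<in> S" "w \<in> V" "w \<notin> S" using assms(2-4) by blast
  then have "(v, w) \<in> {(x, y). {x, y} \<in> E}\<^sup>*"
    using assms(1,2) by (auto simp: connected_graph_def)
  then have "w \<in> S \<or> (\<exists>x y. x \<in> S \<and> y \<notin> S \<and> {x, y} \<in> E)"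
    by (induction rule: rtrancl_induct) (use vw in blast)+
  then obtain x y where xy: "x \<in> S" "y \<notin> S" "{x, y} \<in> E" using vw by blast
  moreover have "y \<in> V" using assms(1) xy by (auto simp: connected_graph_def simple_graph_def)
  ultimately show thesis using that by blast
qed

text \<open>An induction principle that plays the role of a tree traversal: the vertex set is
  exhausted one vertex at a time through crossing edges. The condition
  \<open>F \<subseteq> Pow S\<close> tells the step that the new edge, whose end \<open>y\<close> is
  outside \<open>S\<close>, is not yet in \<open>F\<close>.\<close>

lemma connected_graph_grow:
  assumes G: "connected_graph V E" and r: "r \<in> V"
    and base: "P {r} {}"
    and step: "\<And>S F x y. \<lbrakk>P S F; S \<subseteq> V; F \<subseteq> E; F \<subseteq> Pow S; x \<in> S; y \<in> V - S; {x, y} \<in> E\<rbrakk>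
      \<Longrightarrow> P (insert y S) (insert {x, y} F)"
  obtains F where "F \<subseteq> E" "P V F"
proof -
  have fin: "finite V" using G by (simp add: connected_graph_def simple_graph_def)
  have "\<exists>S F. S \<subseteq> V \<and> card S = Suc n \<and> F \<subseteq> E \<and> F \<subseteq> Pow S \<and> P S F" if "Suc n \<le> card V" for n
    using that
  proof (induction n)
    case 0
    then show ?case using r base by (intro exI[of _ "{r}"] exI[of _ "{}"]) auto
  next
    case (Suc n)
    then obtain S F where SF: "S \<subseteq> V" "card S = Suc n" "F \<subseteq> E" "F \<subseteq> Pow S" "P S F" by auto
    then have "S \<noteq> {}" "S \<noteq> V" using Suc.prems by auto
    then obtain x y where xy: "x \<in> S" "y \<in> V - S" "{x, y} \<in> E"
      using crossing_edge[OF G SF(1)] by metis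
    have "P (insert y S) (insert {x, y} F)" using step SF xy by blast
    moreover have "card (insert y S) = Suc (Suc n)"
      using SF xy fin by (simp add: finite_subset)
    ultimately show ?case using SF xy
      by (intro exI[of _ "insert y S"] exI[of _ "insert {x, y} F"]) auto
  qed
  moreover have "card V > 0" using fin r card_gt_0_iff by blast
  ultimately obtain S F where "S \<subseteq> V" "card S = card V" "F \<subseteq> E" "P S F"
    by (metis Suc_pred order_refl)
  moreover from this have "S = V" using fin card_subset_eq by blast
  ultimately show thesis using that by blast
qed

lemma connected_graph_finite_edges:
  assumes "connected_graph V E" shows "finite E"
  using assms finite_subset[of E "Pow V"] by (auto simp: connected_graph_def simple_graph_def)

lemma connected_graph_card_edges:
  assumes "connected_graph V E" "V \<noteq> {}"
  shows "card V \<le> Suc (card E)"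
proof -
  obtain r where r: "r \<in> V" using assms by blast
  have fin: "finite V" using assms by (simp add: connected_graph_def simple_graph_def)
  note finE = connected_graph_finite_edges[OF assms(1)]
  obtain F where "F \<subseteq> E" "card V = Suc (card F)"
  proof (rule connected_graph_grow[OF assms(1) r, of "\<lambda>S F. card S = Suc (card F)"])
    fix S F x y
    assume "card S = Suc (card F)" "S \<subseteq> V" "F \<subseteq> E" "F \<subseteq> Pow S" "y \<in> V - S"
    moreover from this have "finite S" "finite F" "{x, y} \<notin> F"
      using fin finE by (auto intro: finite_subset)
    ultimately show "card (insert y S) = Suc (card (insert {x, y} F))" by simp
  qed auto
  then show ?thesis using card_mono[OF finE] by simp
qed

section \<open>Walks and short-cutting\<close>

fun walk_length :: "('a \<Rightarrow> 'a \<Rightarrow> real) \<Rightarrow> 'a list \<Rightarrow> real" where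
  "walk_length d (x # y # zs) = d x y + walk_length d (y # zs)"
| "walk_length d _ = 0"

text \<open>Deleting entries of a walk can make two equal ones adjacent; such a pair is skipped,
  since it would contribute a singleton instead of an edge.\<close>

fun walk_edges :: "'a list \<Rightarrow> 'a set set" where
  "walk_edges (x # y # zs) = (if x = y then {} else {{x, y}}) \<union> walk_edges (y # zs)"
| "walk_edges _ = {}"

lemma walk_length_detour:
  "walk_length d (as @ x # y # x # bs) = walk_length d (as @ x # bs) + d x y + d y x"
proof (induction as)
  case (Cons a as)
  then show ?case by (cases as) auto
qed simp

text \<open>Each edge added during the growth is inserted as a detour \<open>x, y, x\<close>, so the
  walk uses every edge of \<open>F\<close> exactly twice. The inequality enters only in passing from
  \<open>F\<close> to \<open>E\<close>.\<close>

lemma spanning_walk: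
  assumes G: "connected_graph V E" "V \<noteq> {}"
    and d: "\<And>x y. d x y \<ge> 0" "\<And>x y. d x y = d y x"
  obtains w where "set w = V" "walk_length d w \<le> 2 * graph_length d E"
proof -
  obtain r where r: "r \<in> V" using G by blast
  have el: "edge_length d {x, y} = d x y" for x y using edge_length_pair d(2) by metis
  have sg: "\<And>e. e \<in> E \<Longrightarrow> card e = 2" using G by (auto simp: connected_graph_def simple_graph_def)
  have nn: "edge_length d e \<ge> 0" if "e \<in> E" for e
    using sg[OF that] d(1) el by (metis card_2_iff)
  note finE = connected_graph_finite_edges[OF G(1)]
  obtain F where F: "F \<subseteq> E" "\<exists>w. set w = V \<and> walk_length d w = 2 * graph_length d F"
  proof (rule connected_graph_grow[OF G(1) r,
        of "\<lambda>S F. \<exists>w. set w = S \<and> walk_length d w = 2 * graph_length d F"])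
    show "\<exists>w. set w = {r} \<and> walk_length d w = 2 * graph_length d {}"
      by (rule exI[of _ "[r]"]) (simp add: graph_length_def)
  next
    fix S F x y
    assume *: "\<exists>w. set w = S \<and> walk_length d w = 2 * graph_length d F" "F \<subseteq> E" "F \<subseteq> Pow S"
      "x \<in> S" "y \<in> V - S"
    then obtain w where w: "set w = S" "walk_length d w = 2 * graph_length d F" by blast
    then obtain as bs where ab: "w = as @ x # bs" using *(4) split_list by metis
    have "finite F" "{x, y} \<notin> F" using * finE by (auto intro: finite_subset)
    then have "walk_length d (as @ x # y # x # bs) = 2 * graph_length d (insert {x, y} F)"
      using w(2) d(2)[of y x] unfolding ab walk_length_detour graph_length_def by (simp add: el)
    moreover have "set (as @ x # y # x # bs) = insert y S" using w(1) ab by auto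
    ultimately show "\<exists>w. set w = insert y S \<and> walk_length d w = 2 * graph_length d (insert {x, y} F)"
      by blast
  qed auto
  moreover have "graph_length d F \<le> graph_length d E"
    unfolding graph_length_def using F(1) finE nn by (intro sum_mono2) auto
  ultimately show thesis using that by force
qed

lemma walk_length_filter:
  assumes "\<And>x y. d x y \<ge> 0"
    and "\<And>x y z. x \<in> V \<Longrightarrow> y \<in> V \<Longrightarrow> z \<in> V \<Longrightarrow> d x z \<le> d x y + d y z"
    and "set w \<subseteq> V"
  shows "walk_length d (filter P w) \<le> walk_length d w"
proof -
  \<comment> \<open>With a kept entry \<open>x\<close> in front, each deletion is one triangle
    inequality between \<open>x\<close> and the next kept entry. Entries deleted before the first
    kept one only lose nonnegative terms.\<close>
  have *: "walk_length d (x # filter P w) \<le> walk_length d (x # w)" if "set w \<subseteq> V" "x \<in> V" for x w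
    using that
  proof (induction w arbitrary: x)
    case (Cons y w)
    have "walk_length d (x # filter P w) \<le> d x y + walk_length d (y # filter P w)"
    proof (cases "filter P w")
      case (Cons z zs)
      then have "z \<in> V" using Cons.prems by (metis filter_is_subset in_mono list.set_intros(1) set_subset_Cons subset_trans)
      with Cons Cons.prems assms(2)[of x y z] show ?thesis by simp
    qed (simp add: assms(1))
    then show ?case using Cons.IH[of y] Cons.IH[of x] Cons.prems by auto
  qed simp
  show ?thesis using assms(3)
  proof (induction w)
    case (Cons x w)
    have "walk_length d w \<le> walk_length d (x # w)" by (cases w) (auto simp: assms(1))
    with Cons *[of w x] show ?case by auto
  qed simp
qed

text \<open>Every entry is reachable from the head, and reachability is symmetric, so any two
  entries are joined through the head.\<close>

lemma walk_edges_connected: "connected_graph (set w) (walk_edges w)"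
proof -
  have "e \<subseteq> set w \<and> card e = 2" if "e \<in> walk_edges w" for e
    using that by (induction w rule: walk_edges.induct) (auto split: if_splits)
  moreover have sym: "sym ({(x, y). {x, y} \<in> E}\<^sup>*)" for E :: "'a set set"
    by (rule sym_rtrancl) (auto simp: sym_def insert_commute)
  moreover have "(hd w, v) \<in> {(x, y). {x, y} \<in> walk_edges w}\<^sup>*" if "v \<in> set w" for v
    using that
  proof (induction w rule: walk_edges.induct)
    case (1 x y zs)
    let ?R = "{(u, v). {u, v} \<in> walk_edges (x # y # zs)}"
    have xy: "(x, y) \<in> ?R\<^sup>*" by (cases "x = y") auto
    have "{(u, v). {u, v} \<in> walk_edges (y # zs)}\<^sup>* \<subseteq> ?R\<^sup>*" by (rule rtrancl_mono) auto
    then show ?case using 1 xy by (auto intro: rtrancl_trans)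
  qed auto
  ultimately show ?thesis unfolding connected_graph_def simple_graph_def
    by (meson List.finite_set rtrancl_trans symD)
qed

lemma walk_edges_finite: "finite (walk_edges w)"
  by (induction w rule: walk_edges.induct) auto

text \<open>Equality may fail because an edge used several times occurs once in the set of
  edges.\<close>

lemma graph_length_walk_edges:
  assumes d: "\<And>x y. d x y \<ge> 0" "\<And>x y. d x y = d y x"
  shows "graph_length d (walk_edges w) \<le> walk_length d w"
proof (induction w rule: walk_edges.induct)
  case (1 x y zs)
  have "graph_length d (walk_edges (x # y # zs)) \<le> d x y + graph_length d (walk_edges (y # zs))"
    using d edge_length_pair[of d x y, OF d(2)] walk_edges_finite[of "y # zs"]
    by (auto simp: graph_length_def sum.insert_if)
  with 1 show ?case by simp
qed (auto simp: graph_length_def)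

lemma connected_subset_graph:
  assumes "connected_graph V E" "M \<subseteq> V"
    and d: "\<And>x y. d x y \<ge> 0" "\<And>x y. d x y = d y x"
    and tri: "\<And>x y z. x \<in> V \<Longrightarrow> y \<in> V \<Longrightarrow> z \<in> V \<Longrightarrow> d x z \<le> d x y + d y z"
  obtains E' where "connected_graph M E'" "graph_length d E' \<le> 2 * graph_length d E"
proof (cases "V = {}")
  case True
  then show thesis using that[of E] assms graph_length_nonneg[of V E d] by auto
next
  case False
  obtain w where w: "set w = V" "walk_length d w \<le> 2 * graph_length d E"
    by (rule spanning_walk[OF assms(1) False d])
  let ?w = "filter (\<lambda>x. x \<in> M) w"
  have "set ?w = M" using w assms(2) by auto
  then have "connected_graph M (walk_edges ?w)" using walk_edges_connected[of ?w] by simp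
  moreover have "graph_length d (walk_edges ?w) \<le> 2 * graph_length d E"
    using graph_length_walk_edges[of d ?w, OF d] walk_length_filter[of d V w, OF d(1) tri] w
    by (metis (no_types, lifting) order_refl order_trans)
  ultimately show thesis using that by blast
qed

section \<open>Spanning trees and estimates for \<open>mst\<close>\<close>

lemma connected_graph_remove_cycle_edge:
  assumes G: "connected_graph V E" and c: "graph_cycle E c"
  shows "connected_graph V (E - {{last c, hd c}})"
proof -
  let ?E = "E - {{last c, hd c}}"
  let ?R = "{(x, y). {x, y} \<in> ?E}"
  have c': "length c \<ge> 3" "distinct c" "\<And>i. Suc i < length c \<Longrightarrow> {c ! i, c ! Suc i} \<in> E"
    using c by (auto simp: graph_cycle_def)
  then have ne: "c \<noteq> []" by auto
  have "(c ! i, c ! Suc i) \<in> ?R" if "Suc i < length c" for i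
  proof -
    \<comment> \<open>For distinct entries, equality would force \<open>i = 0\<close> and
      \<open>Suc i = length c - 1\<close>, a cycle of length 2.\<close>
    have "{c ! i, c ! Suc i} \<noteq> {c ! (length c - 1), c ! 0}"
      using that c'(1) ne by (auto simp: doubleton_eq_iff nth_eq_iff_index_eq[OF c'(2)])
    then show ?thesis using c'(3)[OF that] ne by (simp add: last_conv_nth hd_conv_nth)
  qed
  then have "(c ! 0, c ! i) \<in> ?R\<^sup>*" if "i < length c" for i
    using that by (induction i) (auto intro: rtrancl_into_rtrancl)
  from this[of "length c - 1"] have *: "(hd c, last c) \<in> ?R\<^sup>*"
    using ne by (simp add: last_conv_nth hd_conv_nth)
  have "sym (?R\<^sup>*)" by (rule sym_rtrancl) (auto simp: sym_def insert_commute)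
  with * have **: "(last c, hd c) \<in> ?R\<^sup>*" by (metis symD)
  \<comment> \<open>Each use of the removed edge, in either direction, is rerouted along the rest of
    the cycle.\<close>
  have "{(x, y). {x, y} \<in> E} \<subseteq> ?R\<^sup>*"
    using * ** by (auto simp: doubleton_eq_iff)
  then have "{(x, y). {x, y} \<in> E}\<^sup>* \<subseteq> ?R\<^sup>*" by (metis rtrancl_subset_rtrancl)
  then show ?thesis using G unfolding connected_graph_def simple_graph_def by blast
qed

lemma spanning_tree:
  assumes "connected_graph V E"
  obtains E' where "E' \<subseteq> E" "tree_graph V E'"
proof -
  have "\<exists>E' \<subseteq> E. tree_graph V E'"
    using assms
  proof (induction "card E" arbitrary: E rule: less_induct)
    case less
    show ?case
    proof (cases "\<exists>c. graph_cycle E c")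
      case True
      then obtain c where c: "graph_cycle E c" by blast
      then have "card (E - {{last c, hd c}}) < card E"
        using connected_graph_finite_edges[OF less.prems]
        by (intro card_Diff1_less) (auto simp: graph_cycle_def)
      then show ?thesis
        using less.hyps connected_graph_remove_cycle_edge[OF less.prems c] by blast
    next
      case False
      then show ?thesis using less.prems by (auto simp: tree_graph_def)
    qed
  qed
  then show thesis using that by blast
qed

text \<open>\<open>Min\<close> is meaningful for finite nonempty sets only. This is the finiteness;
  nonemptiness comes from \<open>spanning_tree\<close>.\<close>

lemma finite_tree_lengths:
  assumes "finite M" shows "finite {graph_length d E | E. tree_graph M E}"
proof -
  have "{graph_length d E | E. tree_graph M E} \<subseteq> graph_length d ` Pow (Pow M)"
    by (auto simp: tree_graph_def connected_graph_def simple_graph_def)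
  then show ?thesis using assms by (meson finite_Pow_iff finite_imageI finite_subset)
qed

text \<open>Allows arbitrary connected graphs as competitors: passing to a spanning tree only drops
  edges of nonnegative length. Graphs obtained from walks need not be checked for cycles.\<close>

lemma mst_le:
  assumes "connected_graph M E" "\<And>x y. d x y \<ge> 0" "\<And>x y. d x y = d y x"
  shows "mst d M \<le> graph_length d E"
proof -
  obtain E' where E': "E' \<subseteq> E" "tree_graph M E'" using spanning_tree[OF assms(1)] by blast
  have fin: "finite M" using assms(1) by (simp add: connected_graph_def simple_graph_def)
  have "mst d M \<le> graph_length d E'"
    unfolding mst_def by (rule Min_le) (use finite_tree_lengths[OF fin] E' in auto)
  also have "\<dots> \<le> graph_length d E"
    unfolding graph_length_def
  proof (rule sum_mono2[OF connected_graph_finite_edges[OF assms(1)] E'(1)])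
    fix e assume "e \<in> E - E'"
    then have "card e = 2" using assms(1) by (simp add: connected_graph_def simple_graph_def)
    then show "edge_length d e \<ge> 0" using assms(2,3) edge_length_pair by (metis card_2_iff)
  qed
  finally show ?thesis .
qed

lemma mst_ge:
  assumes M: "finite M" "M \<noteq> {}" and sym: "\<And>x y. d x y = d y x" and "\<delta> \<ge> 0"
    and ge: "\<And>x y. x \<in> M \<Longrightarrow> y \<in> M \<Longrightarrow> x \<noteq> y \<Longrightarrow> \<delta> \<le> d x y"
  shows "(real (card M) - 1) * \<delta> \<le> mst d M"
  unfolding mst_def
proof (rule Min.boundedI[OF finite_tree_lengths[OF M(1)]])
  show "{graph_length d E |E. tree_graph M E} \<noteq> {}"
    by (rule spanning_tree[OF connected_graph_complete[OF M(1)]]) blast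
next
  fix l assume "l \<in> {graph_length d E |E. tree_graph M E}"
  then obtain E where E: "connected_graph M E" "l = graph_length d E"
    by (auto simp: tree_graph_def)
  have "\<delta> \<le> edge_length d e" if "e \<in> E" for e
  proof -
    have "e \<subseteq> M" "card e = 2" using that E by (auto simp: connected_graph_def simple_graph_def)
    then obtain x y where "e = {x, y}" "x \<noteq> y" "x \<in> M" "y \<in> M" by (auto simp: card_2_iff)
    then show ?thesis using ge edge_length_pair[of d x y, OF sym] by simp
  qed
  then have "real (card E) * \<delta> \<le> l"
    unfolding E graph_length_def by (metis sum_bounded_below)
  moreover have "(real (card M) - 1) * \<delta> \<le> real (card E) * \<delta>"
    using connected_graph_card_edges[OF E(1) M(2)] assms(4) by (intro mult_right_mono) auto
  ultimately show "(real (card M) - 1) * \<delta> \<le> l" by linarith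
qed

section \<open>Ratios in an arbitrary metric space\<close>

lemma smt_ge_half_mst:
  assumes "finite M" "M \<subseteq> mspace Z"
  shows "mst (mdist Z) M / 2 \<le> smt (mspace Z) (mdist Z) M"
  unfolding smt_def
proof (rule cInf_greatest)
  show "{graph_length (mdist Z) E | V E. connected_graph V E \<and> V \<subseteq> mspace Z \<and> M \<subseteq> V} \<noteq> {}"
    using connected_graph_complete[OF assms(1)] assms(2) by blast
next
  fix l
  assume "l \<in> {graph_length (mdist Z) E | V E. connected_graph V E \<and> V \<subseteq> mspace Z \<and> M \<subseteq> V}"
  then obtain V E where G: "connected_graph V E" "V \<subseteq> mspace Z" "M \<subseteq> V"
    and l: "l = graph_length (mdist Z) E" by blast
  obtain E' where "connected_graph M E'" "graph_length (mdist Z) E' \<le> 2 * l"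
    unfolding l
    by (rule connected_subset_graph[OF G(1,3), of "mdist Z"])
      (use G(2) in \<open>auto simp: mdist_commute intro: mdist_triangle\<close>)
  then show "mst (mdist Z) M / 2 \<le> l"
    using mst_le[of M E' "mdist Z"] by (force simp: mdist_commute)
qed

text \<open>A tree on the image is pulled back along the inverse of \<open>\<mu>\<close>. By
  \<open>mst_le\<close> it is enough that the result is connected.\<close>

lemma mst_image_ge:
  assumes M: "finite M" and inj: "inj_on \<mu> M"
    and d: "\<And>x y. d x y \<ge> 0" "\<And>x y. d x y = d y x"
    and d': "\<And>x y. d' x y \<ge> 0" "\<And>x y. d' x y = d' y x"
    and iso: "\<And>x y. x \<in> M \<Longrightarrow> y \<in> M \<Longrightarrow> d' (\<mu> x) (\<mu> y) = d x y"
  shows "mst d M \<le> mst d' (\<mu> ` M)"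
  unfolding mst_def[of d']
proof (rule Min.boundedI)
  show "finite {graph_length d' E | E. tree_graph (\<mu> ` M) E}" using finite_tree_lengths M by blast
  show "{graph_length d' E | E. tree_graph (\<mu> ` M) E} \<noteq> {}"
    by (rule spanning_tree[OF connected_graph_complete[of "\<mu> ` M"]]) (use M in auto)
next
  fix l assume "l \<in> {graph_length d' E | E. tree_graph (\<mu> ` M) E}"
  then obtain E where E: "connected_graph (\<mu> ` M) E" "l = graph_length d' E"
    by (auto simp: tree_graph_def)
  let ?h = "inv_into M \<mu>"
  have h: "inj_on ?h (\<mu> ` M)" "?h ` \<mu> ` M = M" using inj by (auto simp: inj_on_inv_into)
  have "connected_graph M ((`) ?h ` E)" using connected_graph_image[OF E(1) h(1)] h(2) by simp
  then have "mst d M \<le> graph_length d ((`) ?h ` E)" by (rule mst_le[OF _ d])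
  also have "\<dots> = l"
    unfolding E(2) by (rule graph_length_image[OF E(1) h(1) d'(2) d(2)]) (use inj iso in auto)
  finally show "mst d M \<le> l" .
qed

lemma mf_ge_half_mst:
  assumes M: "finite M" "M \<subseteq> mspace Z"
  shows "mst (mdist Z) M / 2 \<le> mf (mdist Z) M"
  unfolding mf_def
proof (rule cInf_greatest)
  let ?h = "\<lambda>v. real (to_nat_on M v)"
  have h: "inj_on ?h M"
    using inj_on_to_nat_on[of M] M(1) by (simp add: countable_finite inj_on_def)
  have V: "mspace (submetric Z M) = M" using M(2) by auto
  obtain Z1 :: "real metric" where Z1: "mspace Z1 = ?h ` M"
    and d1: "\<And>x y. x \<in> M \<Longrightarrow> y \<in> M \<Longrightarrow> mdist Z1 (?h x) (?h y) = mdist Z x y"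
    using metric_transport[of ?h "submetric Z M"] h unfolding V mdist_submetric by blast
  \<comment> \<open>\<open>Inf\<close> of the empty set would be uninformative; a copy of
    \<open>M\<close> itself, coded by reals, is an ambient space.\<close>
  have "smt (mspace Z1) (mdist Z1) (?h ` M) \<in> {r. \<exists>(Z1 :: real metric) \<mu>. \<mu> ` M \<subseteq> mspace Z1 \<and>
     (\<forall>x\<in>M. \<forall>y\<in>M. mdist Z1 (\<mu> x) (\<mu> y) = mdist Z x y) \<and>
     smt (mspace Z1) (mdist Z1) (\<mu> ` M) \<le> r}"
    by (rule CollectI, rule exI[of _ Z1], rule exI[of _ ?h]) (use Z1 d1 in simp)
  then show "{r. \<exists>(Z1 :: real metric) \<mu>. \<mu> ` M \<subseteq> mspace Z1 \<and>
     (\<forall>x\<in>M. \<forall>y\<in>M. mdist Z1 (\<mu> x) (\<mu> y) = mdist Z x y) \<and>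
     smt (mspace Z1) (mdist Z1) (\<mu> ` M) \<le> r} \<noteq> {}"
    by (metis empty_iff)
next
  fix r
  assume "r \<in> {r. \<exists>(Z1 :: real metric) \<mu>. \<mu> ` M \<subseteq> mspace Z1 \<and>
     (\<forall>x\<in>M. \<forall>y\<in>M. mdist Z1 (\<mu> x) (\<mu> y) = mdist Z x y) \<and>
     smt (mspace Z1) (mdist Z1) (\<mu> ` M) \<le> r}"
  then obtain Z1 :: "real metric" and \<mu> where \<mu>: "\<mu> ` M \<subseteq> mspace Z1"
    "\<And>x y. x \<in> M \<Longrightarrow> y \<in> M \<Longrightarrow> mdist Z1 (\<mu> x) (\<mu> y) = mdist Z x y"
    "smt (mspace Z1) (mdist Z1) (\<mu> ` M) \<le> r" by blast
  have "inj_on \<mu> M"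
  proof (rule inj_onI)
    fix x y assume xy: "x \<in> M" "y \<in> M" "\<mu> x = \<mu> y"
    then have "\<mu> x \<in> mspace Z1" using \<mu>(1) by blast
    then have "mdist Z1 (\<mu> x) (\<mu> x) = 0" by simp
    then have "mdist Z x y = 0" using \<mu>(2)[of x y] xy by metis
    then show "x = y" using xy M(2) mdist_zero by (metis subsetD)
  qed
  then have "mst (mdist Z) M \<le> mst (mdist Z1) (\<mu> ` M)"
    using M(1) \<mu>(2) by (intro mst_image_ge) (auto simp: mdist_commute)
  then show "mst (mdist Z) M / 2 \<le> r"
    using smt_ge_half_mst[of "\<mu> ` M" Z1] M(1) \<mu>(1,3) by simp
qed

text \<open>Since \<open>x / 0 = 0\<close>, the lower bound 1/2 for the ratios depends on positive
  denominators. Here every edge is at least the smallest of the finitely many nonzero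
  distances.\<close>

lemma mst_pos:
  assumes M: "finite M" "M \<subseteq> mspace Z" "card M \<ge> 2"
  shows "mst (mdist Z) M > 0"
proof -
  let ?D = "(\<lambda>(x, y). mdist Z x y) ` {p \<in> M \<times> M. fst p \<noteq> snd p}"
  have ne: "M \<noteq> {}" using M(3) by auto
  have "\<exists>x y. x \<in> M \<and> y \<in> M \<and> x \<noteq> y"
    using M(3) by (metis One_nat_def card_le_Suc0_iff_eq M(1) not_numeral_le_zero numeral_2_eq_2 not_less_eq_eq order_refl)
  then have D: "finite ?D" "?D \<noteq> {}" using M(1) by auto
  have "Min ?D \<in> ?D" by (rule Min_in[OF D])
  moreover have "a > 0" if "a \<in> ?D" for a
    using that M(2) by (auto simp: order_less_le subset_iff)
  ultimately have "Min ?D > 0" by blast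
  moreover have "Min ?D \<le> mdist Z x y" if "x \<in> M" "y \<in> M" "x \<noteq> y" for x y
    using that by (intro Min_le[OF D(1)]) auto
  ultimately have "(real (card M) - 1) * Min ?D \<le> mst (mdist Z) M"
    by (intro mst_ge[OF M(1) ne]) (auto simp: mdist_commute)
  moreover have "(real (card M) - 1) * Min ?D > 0" using M(3) \<open>Min ?D > 0\<close> by simp
  ultimately show ?thesis by linarith
qed

lemma mf_le_smt:
  assumes "finite M" "M \<noteq> {}" "M \<subseteq> mspace Z"
  shows "mf (mdist Z) M \<le> smt (mspace Z) (mdist Z) M"
  using mf_le[of M id Z "mdist Z"] assms by simp

lemma smt_le_star:
  assumes M: "finite M" "M \<subseteq> mspace Z" and c: "c \<in> mspace Z"
  shows "smt (mspace Z) (mdist Z) M \<le> (\<Sum>x\<in>M. mdist Z c x)"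
proof -
  \<comment> \<open>The centre may belong to \<open>M\<close>; removing it avoids a loop.\<close>
  let ?E = "(\<lambda>x. {c, x}) ` (M - {c})"
  let ?R = "{(x, y). {x, y} \<in> ?E}"
  have "(c, x) \<in> ?R\<^sup>*" if "x \<in> insert c M" for x
    using that by (cases "x = c") auto
  moreover have "sym (?R\<^sup>*)" by (rule sym_rtrancl) (simp add: sym_def insert_commute)
  ultimately have "(x, y) \<in> ?R\<^sup>*" if "x \<in> insert c M" "y \<in> insert c M" for x y
    using that by (meson rtrancl_trans symD)
  then have "connected_graph (insert c M) ?E"
    using M(1) by (auto simp: connected_graph_def simple_graph_def card_2_iff)
  then have "smt (mspace Z) (mdist Z) M \<le> graph_length (mdist Z) ?E"
    by (rule smt_le) (use M c in auto)
  also have "\<dots> = (\<Sum>x\<in>M - {c}. mdist Z c x)"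
    unfolding graph_length_def
    by (subst sum.reindex) (auto simp: inj_on_def doubleton_eq_iff edge_length_pair[OF mdist_commute])
  also have "\<dots> \<le> (\<Sum>x\<in>M. mdist Z c x)"
    using M(1) by (intro sum_mono2) auto
  finally show ?thesis .
qed

text \<open>Both ratios are treated at once: \<open>F\<close> stands for \<open>smt\<close> or
  \<open>mf\<close>, and only the squeeze between half of \<open>mst\<close> and \<open>smt\<close>
  enters.\<close>

lemma ratios_eq_half:
  fixes M :: "nat \<Rightarrow> 'a set" and c :: "nat \<Rightarrow> 'a"
  assumes M: "\<And>n. finite (M n)" "\<And>n. card (M n) = n" "\<And>n. M n \<subseteq> mspace Z"
    and c: "\<And>n. c n \<in> mspace Z" "\<And>n x. x \<in> M n \<Longrightarrow> mdist Z (c n) x \<le> r"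
    and e: "\<And>n x y. x \<in> M n \<Longrightarrow> y \<in> M n \<Longrightarrow> x \<noteq> y \<Longrightarrow> 2 * r \<le> mdist Z x y"
    and "r > 0"
  shows "steiner_ratio (mspace Z) (mdist Z) = 1 / 2"
    and "steiner_gromov_ratio (mspace Z) (mdist Z) = 1 / 2"
proof -
  have inf: "Inf {F M / mst (mdist Z) M | M. finite M \<and> M \<subseteq> mspace Z \<and> card M \<ge> 2} = 1 / 2"
    if ge: "\<And>M. finite M \<Longrightarrow> M \<subseteq> mspace Z \<Longrightarrow> mst (mdist Z) M / 2 \<le> F M"
      and le: "\<And>M. finite M \<Longrightarrow> M \<subseteq> mspace Z \<Longrightarrow> M \<noteq> {} \<Longrightarrow> F M \<le> smt (mspace Z) (mdist Z) M"
    for F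
  proof (rule antisym)
    let ?A = "{F M / mst (mdist Z) M | M. finite M \<and> M \<subseteq> mspace Z \<and> card M \<ge> 2}"
    have lb: "1 / 2 \<le> a" if a: "a \<in> ?A" for a
    proof -
      obtain M where M: "a = F M / mst (mdist Z) M" "finite M" "M \<subseteq> mspace Z" "card M \<ge> 2"
        using a by blast
      then show ?thesis
        unfolding M(1) using ge[of M] mst_pos[of M Z] by (simp add: pos_le_divide_eq)
    qed
    have ub: "\<exists>a\<in>?A. a \<le> 1 / 2 + 1 / (2 * real (Suc n))" for n
    proof -
      \<comment> \<open>The shift by two makes every set admissible. The star then has length at
        most \<open>(n + 2) * r\<close>, against at least \<open>n + 1\<close> tree edges of length
        at least \<open>2 * r\<close>.\<close>
      let ?M = "M (Suc (Suc n))" and ?c = "c (Suc (Suc n))"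
      have ne: "?M \<noteq> {}" using M(2)[of "Suc (Suc n)"] by auto
      have "F ?M \<le> (\<Sum>x\<in>?M. mdist Z ?c x)"
        using le[OF M(1,3) ne] smt_le_star[OF M(1,3) c(1)] by (rule order_trans)
      also have "\<dots> \<le> real (n + 2) * r"
        using sum_bounded_above[of ?M "mdist Z ?c" r] c(2) M(2) by simp
      finally have F: "F ?M \<le> real (n + 2) * r" .
      have m: "real (Suc n) * (2 * r) \<le> mst (mdist Z) ?M"
        using mst_ge[OF M(1) ne, of "mdist Z" "2 * r"] M(2) e \<open>r > 0\<close> by (simp add: mdist_commute)
      have p: "mst (mdist Z) ?M > 0" by (rule mst_pos) (use M in auto)
      have "F ?M / mst (mdist Z) ?M \<le> (real (n + 2) * r) / (real (Suc n) * (2 * r))"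
        using F m p \<open>r > 0\<close> by (intro frac_le) auto
      also have "\<dots> = 1 / 2 + 1 / (2 * real (Suc n))"
        using \<open>r > 0\<close> by (simp add: divide_simps) (simp add: algebra_simps)
      finally have "F ?M / mst (mdist Z) ?M \<le> 1 / 2 + 1 / (2 * real (Suc n))" .
      moreover have "finite ?M \<and> ?M \<subseteq> mspace Z \<and> card ?M \<ge> 2" using M by simp
      ultimately show ?thesis by blast
    qed
    have "?A \<noteq> {}" using ub[of 0] by (rule bexE) (metis empty_iff)
    then show "1 / 2 \<le> Inf ?A" using lb by (rule cInf_greatest)
    show "Inf ?A \<le> 1 / 2"
    proof (rule field_le_epsilon)
      fix \<epsilon> :: real assume "\<epsilon> > 0"
      then obtain n where n: "1 / real (Suc n) < \<epsilon>" using nat_approx_posE by blast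
      obtain a where a: "a \<in> ?A" "a \<le> 1 / 2 + 1 / (2 * real (Suc n))"
        using ub[of n] by (rule bexE)
      have "Inf ?A \<le> a" by (rule cInf_lower[OF a(1)]) (rule bdd_belowI[OF lb])
      moreover have "1 / (2 * real (Suc n)) \<le> 1 / real (Suc n)" by (simp add: divide_simps)
      ultimately show "Inf ?A \<le> 1 / 2 + \<epsilon>" using a n by linarith
    qed
  qed
  show "steiner_ratio (mspace Z) (mdist Z) = 1 / 2"
    unfolding steiner_ratio_def by (rule inf[OF smt_ge_half_mst order_refl])
  show "steiner_gromov_ratio (mspace Z) (mdist Z) = 1 / 2"
    unfolding steiner_gromov_ratio_def by (rule inf[OF mf_ge_half_mst mf_le_smt])
qed

section \<open>The Gromov--Hausdorff distance is a metric\<close>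

text \<open>The classical notion, with \<open>s\<close> normalised as half of the distortion bound
  so that it is directly comparable with the Gromov--Hausdorff distance.\<close>

definition correspondence :: "'a metric \<Rightarrow> 'b metric \<Rightarrow> ('a \<times> 'b) set \<Rightarrow> real \<Rightarrow> bool" where
  "correspondence X Y R s \<longleftrightarrow> R \<subseteq> mspace X \<times> mspace Y \<and>
     (\<forall>x\<in>mspace X. \<exists>y. (x, y) \<in> R) \<and> (\<forall>y\<in>mspace Y. \<exists>x. (x, y) \<in> R) \<and>
     (\<forall>x y x' y'. (x, y) \<in> R \<longrightarrow> (x', y') \<in> R \<longrightarrow> \<bar>mdist X x x' - mdist Y y y'\<bar> \<le> 2 * s)"

lemma correspondenceD:
  assumes "correspondence X Y R s"
  shows "(x, y) \<in> R \<Longrightarrow> x \<in> mspace X" "(x, y) \<in> R \<Longrightarrow> y \<in> mspace Y"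
    and "x \<in> mspace X \<Longrightarrow> \<exists>y. (x, y) \<in> R" "y \<in> mspace Y \<Longrightarrow> \<exists>x. (x, y) \<in> R"
    and "(x, y) \<in> R \<Longrightarrow> (x', y') \<in> R \<Longrightarrow> \<bar>mdist X x x' - mdist Y y y'\<bar> \<le> 2 * s"
  using assms unfolding correspondence_def by auto

lemma correspondence_converse:
  "correspondence X Y R s \<Longrightarrow> correspondence Y X (R\<inverse>) s"
  unfolding correspondence_def by (fastforce simp: abs_minus_commute)

lemma correspondence_relcomp:
  assumes "correspondence X Y R s" "correspondence Y W S t"
  shows "correspondence X W (R O S) (s + t)"
  unfolding correspondence_def
proof (intro conjI ballI allI impI)
  note R = correspondenceD[OF assms(1)] and S = correspondenceD[OF assms(2)]
  show "R O S \<subseteq> mspace X \<times> mspace W" using R(1) S(2) by blast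
  show "\<exists>w. (x, w) \<in> R O S" if "x \<in> mspace X" for x
    using R(3)[OF that] R(2) S(3) by blast
  show "\<exists>x. (x, w) \<in> R O S" if "w \<in> mspace W" for w
    using S(4)[OF that] S(1) R(4) by blast
  fix x w x' w' assume "(x, w) \<in> R O S" "(x', w') \<in> R O S"
  then obtain y y' where "(x, y) \<in> R" "(y, w) \<in> S" "(x', y') \<in> R" "(y', w') \<in> S" by blast
  then have "\<bar>mdist X x x' - mdist Y y y'\<bar> \<le> 2 * s" "\<bar>mdist Y y y' - mdist W w w'\<bar> \<le> 2 * t"
    by (auto intro: R(5) S(5))
  then show "\<bar>mdist X x x' - mdist W w w'\<bar> \<le> 2 * (s + t)" by (auto simp: abs_le_iff)
qed

section \<open>Gluing two spaces along a correspondence\<close>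

definition glue_cross :: "'a metric \<Rightarrow> 'b metric \<Rightarrow> ('a \<times> 'b) set \<Rightarrow> real \<Rightarrow> 'a \<Rightarrow> 'b \<Rightarrow> real" where
  "glue_cross X Y R s x y = Inf ((\<lambda>(a, b). mdist X x a + s + mdist Y b y) ` R)"

fun glue_dist ::
  "'a metric \<Rightarrow> 'b metric \<Rightarrow> ('a \<times> 'b) set \<Rightarrow> real \<Rightarrow> 'a + 'b \<Rightarrow> 'a + 'b \<Rightarrow> real" where
  "glue_dist X Y R s (Inl x) (Inl x') = mdist X x x'"
| "glue_dist X Y R s (Inr y) (Inr y') = mdist Y y y'"
| "glue_dist X Y R s (Inl x) (Inr y) = glue_cross X Y R s x y"
| "glue_dist X Y R s (Inr y) (Inl x) = glue_cross X Y R s x y"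

lemma glue_cross_le:
  assumes "s > 0" "(a, b) \<in> R"
  shows "glue_cross X Y R s x y \<le> mdist X x a + s + mdist Y b y"
  unfolding glue_cross_def
proof (rule cInf_lower)
  show "bdd_below ((\<lambda>(a, b). mdist X x a + s + mdist Y b y) ` R)"
    using assms(1) by (intro bdd_belowI[of _ 0]) (auto intro!: add_nonneg_nonneg)
qed (use assms in force)

lemma glue_cross_ge:
  assumes "R \<noteq> {}" "\<And>a b. (a, b) \<in> R \<Longrightarrow> k \<le> mdist X x a + s + mdist Y b y"
  shows "k \<le> glue_cross X Y R s x y"
  unfolding glue_cross_def using assms by (intro cInf_greatest) auto

text \<open>The cross distance is the infimum over routes that change space once, at a pair of
  \<open>R\<close>, for a toll \<open>s\<close>. The critical triangle inequality is the one for an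
  excursion into the other space and back: it pays two tolls, and \<open>2 * s\<close> covers the
  distortion of \<open>R\<close>.\<close>

lemma glue_metric:
  assumes R: "correspondence X Y R s" and ne: "R \<noteq> {}" and s: "s > 0"
  shows "Metric_space (Inl ` mspace X \<union> Inr ` mspace Y) (glue_dist X Y R s)"
proof -
  let ?c = "glue_cross X Y R s"
  note sub = correspondenceD(1,2)[OF R] and dis = correspondenceD(5)[OF R]
  have pos: "?c x y \<ge> s" for x y
    by (rule glue_cross_ge[OF ne]) simp
  have XXY: "?c x y \<le> mdist X x x' + ?c x' y" if "x \<in> mspace X" "x' \<in> mspace X" for x x' y
  proof -
    have "?c x y - mdist X x x' \<le> ?c x' y"
    proof (rule glue_cross_ge[OF ne])
      fix a b assume "(a, b) \<in> R"
      then show "?c x y - mdist X x x' \<le> mdist X x' a + s + mdist Y b y"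
        using glue_cross_le[OF s, of a b R X Y x y] mdist_triangle[of x X x' a] that sub[of a b] by simp
    qed
    then show ?thesis by simp
  qed
  have XYY: "?c x y \<le> ?c x y' + mdist Y y' y" if "y \<in> mspace Y" "y' \<in> mspace Y" for x y y'
  proof -
    have "?c x y - mdist Y y' y \<le> ?c x y'"
    proof (rule glue_cross_ge[OF ne])
      fix a b assume "(a, b) \<in> R"
      then show "?c x y - mdist Y y' y \<le> mdist X x a + s + mdist Y b y'"
        using glue_cross_le[OF s, of a b R X Y x y] mdist_triangle[of b Y y' y] that sub[of a b] by simp
    qed
    then show ?thesis by simp
  qed
  have XYX: "mdist X x x' \<le> ?c x y + ?c x' y"
    if "x \<in> mspace X" "x' \<in> mspace X" "y \<in> mspace Y" for x x' y
  proof -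
    \<comment> \<open>Both cross distances are infima, so \<open>glue_cross_ge\<close> is applied to
      each in turn with all other terms moved to the left.\<close>
    have "mdist X x x' - ?c x' y \<le> ?c x y"
    proof (rule glue_cross_ge[OF ne])
      fix a b assume ab: "(a, b) \<in> R"
      have "mdist X x x' - (mdist X x a + s + mdist Y b y) \<le> ?c x' y"
      proof (rule glue_cross_ge[OF ne])
        fix a' b' assume ab': "(a', b') \<in> R"
        have "mdist X x x' \<le> mdist X x a + mdist X a a' + mdist X a' x'"
          using mdist_triangle[of x X a x'] mdist_triangle[of a X a' x'] that sub ab ab' by fastforce
        moreover have "mdist Y b b' \<le> mdist Y b y + mdist Y y b'"
          using mdist_triangle[of b Y y b'] that sub ab ab' by blast
        ultimately show "mdist X x x' - (mdist X x a + s + mdist Y b y) \<le> mdist X x' a' + s + mdist Y b' y"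
          using dis[OF ab ab'] by (simp add: mdist_commute[of X x' a'] mdist_commute[of Y y b'])
      qed
      then show "mdist X x x' - ?c x' y \<le> mdist X x a + s + mdist Y b y" by linarith
    qed
    then show ?thesis by simp
  qed
  have YXY: "mdist Y y y' \<le> ?c x y + ?c x y'"
    if "y \<in> mspace Y" "y' \<in> mspace Y" "x \<in> mspace X" for x y y'
  proof -
    have "mdist Y y y' - ?c x y' \<le> ?c x y"
    proof (rule glue_cross_ge[OF ne])
      fix a b assume ab: "(a, b) \<in> R"
      have "mdist Y y y' - (mdist X x a + s + mdist Y b y) \<le> ?c x y'"
      proof (rule glue_cross_ge[OF ne])
        fix a' b' assume ab': "(a', b') \<in> R"
        have "mdist Y y y' \<le> mdist Y y b + mdist Y b b' + mdist Y b' y'"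
          using mdist_triangle[of y Y b y'] mdist_triangle[of b Y b' y'] that sub ab ab' by fastforce
        moreover have "mdist X a a' \<le> mdist X a x + mdist X x a'"
          using mdist_triangle[of a X x a'] that sub ab ab' by blast
        ultimately show "mdist Y y y' - (mdist X x a + s + mdist Y b y) \<le> mdist X x a' + s + mdist Y b' y'"
          using dis[OF ab ab'] by (simp add: mdist_commute[of X a x] mdist_commute[of Y y b])
      qed
      then show "mdist Y y y' - ?c x y' \<le> mdist X x a + s + mdist Y b y" by linarith
    qed
    then show ?thesis by simp
  qed
  have pos': "?c x y \<ge> 0" "?c x y \<noteq> 0" for x y using pos[of x y] s by linarith+
  show ?thesis
  proof
    fix u v w
    show "0 \<le> glue_dist X Y R s u v" by (cases u; cases v) (auto simp: pos')
    show "glue_dist X Y R s u v = glue_dist X Y R s v u"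
      by (cases u; cases v) (auto simp: mdist_commute)
    assume u: "u \<in> Inl ` mspace X \<union> Inr ` mspace Y" and v: "v \<in> Inl ` mspace X \<union> Inr ` mspace Y"
    then show "glue_dist X Y R s u v = 0 \<longleftrightarrow> u = v" by (auto simp: pos')
    assume "w \<in> Inl ` mspace X \<union> Inr ` mspace Y"
    with u v show "glue_dist X Y R s u w \<le> glue_dist X Y R s u v + glue_dist X Y R s v w"
      using XXY XYY XYX YXY
      by (auto intro: mdist_triangle) (metis add.commute mdist_commute)+
  qed
qed

text \<open>The definition asks for strict inequalities, so \<open>s\<close> itself may be
  inadmissible, but every \<open>s + \<epsilon>\<close> is admissible.\<close>

lemma hausdorff_distance_le:
  assumes "s > 0" "\<And>a. a \<in> A \<Longrightarrow> \<exists>b\<in>B. d a b \<le> s" "\<And>b. b \<in> B \<Longrightarrow> \<exists>a\<in>A. d a b \<le> s"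
  shows "hausdorff_distance d A B \<le> s"
proof (rule field_le_epsilon)
  fix \<epsilon> :: real assume "\<epsilon> > 0"
  then have "s + \<epsilon> \<in> {r. r > 0 \<and> (\<forall>a\<in>A. \<exists>b\<in>B. d a b < r) \<and> (\<forall>b\<in>B. \<exists>a\<in>A. d a b < r)}"
    using assms by (force dest: order.strict_trans1[of _ s "s + \<epsilon>"])
  then show "hausdorff_distance d A B \<le> s + \<epsilon>"
    unfolding hausdorff_distance_def by (rule cInf_lower) (auto intro: bdd_belowI[of _ 0])
qed

section \<open>The Gromov--Hausdorff distance through correspondences\<close>

definition GH_bounds :: "real metric \<Rightarrow> real metric \<Rightarrow> real set" where
  "GH_bounds X Y = {r. \<exists>(Z :: real metric) X' Y'.
     X' \<subseteq> mspace Z \<and> Y' \<subseteq> mspace Z \<and>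
     isometric_spaces X (submetric Z X') \<and> isometric_spaces Y (submetric Z Y') \<and>
     hausdorff_distance (mdist Z) X' Y' \<le> r}"

lemma gromov_hausdorff_eq: "gromov_hausdorff X Y = Inf (GH_bounds X Y)"
  unfolding gromov_hausdorff_def GH_bounds_def ..

text \<open>In the glued space the two points of a pair of \<open>R\<close> are at distance at most
  \<open>s\<close>. That space has points in \<open>real + real\<close>;
  \<open>gromov_hausdorff_real\<close> carries the bound back to \<open>real\<close>.\<close>

lemma correspondence_GH_bounds:
  fixes X Y :: "real metric"
  assumes R: "correspondence X Y R s" and ne: "mspace X \<noteq> {}" and s: "s > 0"
  shows "s \<in> GH_bounds X Y"
proof -
  note R' = correspondenceD[OF R]
  have "R \<noteq> {}" using R'(3) ne by blast
  note M = glue_metric[OF R this s]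
  define Z where "Z = metric (Inl ` mspace X \<union> Inr ` mspace Y, glue_dist X Y R s)"
  have mZ: "mspace Z = Inl ` mspace X \<union> Inr ` mspace Y" and dZ: "mdist Z = glue_dist X Y R s"
    unfolding Z_def using Metric_space.mspace_metric[OF M] Metric_space.mdist_metric[OF M] by auto
  have iso: "isometric_spaces X (submetric Z (Inl ` mspace X))"
    unfolding isometric_spaces_def
    by (rule exI[of _ Inl]) (auto simp: mZ dZ bij_betw_def)
  have iso': "isometric_spaces Y (submetric Z (Inr ` mspace Y))"
    unfolding isometric_spaces_def
    by (rule exI[of _ Inr]) (auto simp: mZ dZ bij_betw_def)
  have close: "glue_dist X Y R s (Inl x) (Inr y) \<le> s" if xy: "(x, y) \<in> R" for x y
  proof -
    have "mdist X x x = 0" "mdist Y y y = 0" using R'(1,2)[OF xy] by simp_all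
    then show ?thesis using glue_cross_le[OF s xy, of X Y x y] by simp
  qed
  have "hausdorff_distance (mdist Z) (Inl ` mspace X) (Inr ` mspace Y) \<le> s"
  proof (rule hausdorff_distance_le[OF s])
    fix a :: "real + real" assume "a \<in> Inl ` mspace X"
    then obtain x y where "a = Inl x" "(x, y) \<in> R" using R'(3) by blast
    then show "\<exists>b\<in>Inr ` mspace Y. mdist Z a b \<le> s" using close[of x y] dZ R'(2)[of x y] by auto
  next
    fix b :: "real + real" assume "b \<in> Inr ` mspace Y"
    then obtain x y where "b = Inr y" "(x, y) \<in> R" using R'(4) by blast
    then show "\<exists>a\<in>Inl ` mspace X. mdist Z a b \<le> s" using close[of x y] dZ R'(1)[of x y] by auto
  qed
  with gromov_hausdorff_real[OF _ _ iso iso', of s] show ?thesis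
    unfolding GH_bounds_def by (auto simp: mZ)
qed

lemma compact_metrics_bounded:
  assumes "X \<in> compact_metrics"
  obtains B where "\<And>x y. x \<in> mspace X \<Longrightarrow> y \<in> mspace X \<Longrightarrow> mdist X x y \<le> B"
proof -
  have "compactin (mtopology_of X) (mspace X)"
    using assms by (simp add: compact_metrics_def compact_space_def)
  then have "Metric_space.mbounded (mspace X) (mdist X) (mspace X)"
    unfolding mtopology_of_def
    by (rule Metric_space.compactin_imp_mbounded[OF Metric_space_mspace_mdist])
  then show thesis
    using Metric_space.mbounded_alt[OF Metric_space_mspace_mdist, of X "mspace X"] that by blast
qed

text \<open>Makes the infimum in the Hausdorff distance meaningful, by boundedness of compact
  spaces.\<close>

lemma GH_bounds_hausdorff:
  assumes X: "X \<in> compact_metrics" and Y: "Y \<in> compact_metrics"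
    and Z: "X' \<subseteq> mspace Z" "Y' \<subseteq> mspace Z"
    and iso: "isometric_spaces X (submetric Z X')" "isometric_spaces Y (submetric Z Y')"
  shows "{r. r > 0 \<and> (\<forall>a\<in>X'. \<exists>b\<in>Y'. mdist Z a b < r) \<and> (\<forall>b\<in>Y'. \<exists>a\<in>X'. mdist Z a b < r)} \<noteq> {}"
proof -
  have *: "\<exists>B. \<forall>a\<in>A. \<forall>b\<in>A. mdist Z a b \<le> B" "A \<noteq> {}"
    if A: "W \<in> compact_metrics" "A \<subseteq> mspace Z" "isometric_spaces W (submetric Z A)" for W A
  proof -
    obtain B where B: "\<And>x y. x \<in> mspace W \<Longrightarrow> y \<in> mspace W \<Longrightarrow> mdist W x y \<le> B"
      using compact_metrics_bounded[OF A(1)] by blast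
    obtain f where f: "f ` mspace W = A"
      "\<And>x y. x \<in> mspace W \<Longrightarrow> y \<in> mspace W \<Longrightarrow> mdist Z (f x) (f y) = mdist W x y"
      using A(2,3) unfolding isometric_spaces_def by (auto simp: Int_absorb2 bij_betw_def)
    have "mdist Z a b \<le> B" if "a \<in> A" "b \<in> A" for a b
      using that f B by auto
    then show "\<exists>B. \<forall>a\<in>A. \<forall>b\<in>A. mdist Z a b \<le> B" by blast
    show "A \<noteq> {}" using A(1) f(1) by (auto simp: compact_metrics_def)
  qed
  obtain B C where B: "\<And>a b. a \<in> X' \<Longrightarrow> b \<in> X' \<Longrightarrow> mdist Z a b \<le> B"
    and C: "\<And>a b. a \<in> Y' \<Longrightarrow> b \<in> Y' \<Longrightarrow> mdist Z a b \<le> C"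
    using *[OF X Z(1) iso(1)] *[OF Y Z(2) iso(2)] by blast
  obtain p q where pq: "p \<in> X'" "q \<in> Y'" using *[OF X Z(1) iso(1)] *[OF Y Z(2) iso(2)] by blast
  \<comment> \<open>Points of \<open>X'\<close> reach \<open>q\<close> through \<open>p\<close>,
    points of \<open>Y'\<close> reach \<open>p\<close> through \<open>q\<close>; the 1 gives
    strictness.\<close>
  let ?r = "B + C + mdist Z p q + 1"
  have BC: "0 \<le> B" "0 \<le> C"
    using order_trans[OF mdist_nonneg B[OF pq(1) pq(1)]] order_trans[OF mdist_nonneg C[OF pq(2) pq(2)]] .
  have "mdist Z a q < ?r" if "a \<in> X'" for a
    using mdist_triangle[of a Z p q] B[OF that pq(1)] BC pq that Z by (auto simp: subset_iff)
  moreover have "mdist Z p b < ?r" if "b \<in> Y'" for b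
    using mdist_triangle[of p Z q b] C[OF pq(2) that] BC pq that Z by (auto simp: subset_iff)
  moreover have "?r > 0" using BC mdist_nonneg[of Z p q] by linarith
  ultimately show ?thesis using pq by blast
qed

lemma GH_bounds_nonneg:
  assumes "X \<in> compact_metrics" "Y \<in> compact_metrics" "r \<in> GH_bounds X Y"
  shows "r \<ge> 0"
proof -
  obtain Z :: "real metric" and X' Y' where Z: "X' \<subseteq> mspace Z" "Y' \<subseteq> mspace Z"
     "isometric_spaces X (submetric Z X')" "isometric_spaces Y (submetric Z Y')"
     "hausdorff_distance (mdist Z) X' Y' \<le> r"
    using assms(3) unfolding GH_bounds_def by blast
  have "hausdorff_distance (mdist Z) X' Y' \<ge> 0"
    unfolding hausdorff_distance_def
    using GH_bounds_hausdorff[OF assms(1,2) Z(1-4)] by (rule cInf_greatest) simp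
  with Z(5) show ?thesis by linarith
qed

lemma gromov_hausdorff_le:
  assumes "X \<in> compact_metrics" "Y \<in> compact_metrics" "correspondence X Y R s" "s > 0"
  shows "gromov_hausdorff X Y \<le> s"
  unfolding gromov_hausdorff_eq
proof (rule cInf_lower)
  show "s \<in> GH_bounds X Y"
    using assms correspondence_GH_bounds by (auto simp: compact_metrics_def)
  show "bdd_below (GH_bounds X Y)" using GH_bounds_nonneg[OF assms(1,2)] by (rule bdd_belowI)
qed

lemma GH_bounds_nonempty:
  assumes X: "X \<in> compact_metrics" and Y: "Y \<in> compact_metrics"
  shows "GH_bounds X Y \<noteq> {}"
proof -
  obtain B where B: "\<And>x y. x \<in> mspace X \<Longrightarrow> y \<in> mspace X \<Longrightarrow> mdist X x y \<le> B"
    using compact_metrics_bounded[OF X] by blast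
  obtain C where C: "\<And>x y. x \<in> mspace Y \<Longrightarrow> y \<in> mspace Y \<Longrightarrow> mdist Y x y \<le> C"
    using compact_metrics_bounded[OF Y] by blast
  obtain p q where pq: "p \<in> mspace X" "q \<in> mspace Y"
    using X Y by (auto simp: compact_metrics_def)
  have BC: "0 \<le> B" "0 \<le> C"
    using order_trans[OF mdist_nonneg B[OF pq(1) pq(1)]] order_trans[OF mdist_nonneg C[OF pq(2) pq(2)]] .
  \<comment> \<open>The summand 1 keeps the parameter positive even if both spaces are single
    points.\<close>
  have "correspondence X Y (mspace X \<times> mspace Y) (B + C + 1)"
    unfolding correspondence_def
  proof (intro conjI allI impI)
    fix x y x' y'
    assume "(x, y) \<in> mspace X \<times> mspace Y" "(x', y') \<in> mspace X \<times> mspace Y"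
    then have "mdist X x x' \<le> B" "mdist Y y y' \<le> C" using B C by auto
    then show "\<bar>mdist X x x' - mdist Y y y'\<bar> \<le> 2 * (B + C + 1)"
      using BC mdist_nonneg[of X x x'] mdist_nonneg[of Y y y'] unfolding abs_le_iff by argo
  qed (use pq in auto)
  then have "B + C + 1 \<in> GH_bounds X Y"
    using correspondence_GH_bounds pq(1) BC by fastforce
  then show ?thesis by blast
qed

lemma gromov_hausdorff_nonneg:
  assumes "X \<in> compact_metrics" "Y \<in> compact_metrics"
  shows "gromov_hausdorff X Y \<ge> 0"
  unfolding gromov_hausdorff_eq
  using GH_bounds_nonempty[OF assms] GH_bounds_nonneg[OF assms] by (rule cInf_greatest)

text \<open>Points whose copies in a common ambient space are less than \<open>t\<close> apart
  correspond to each other; exchanging both ends of a segment in this way changes its length by less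
  than \<open>2 * t\<close>.\<close>

lemma gromov_hausdorff_less:
  assumes XY: "X \<in> compact_metrics" "Y \<in> compact_metrics" and less: "gromov_hausdorff X Y < s"
  obtains R where "correspondence X Y R s"
proof -
  obtain r where "r \<in> GH_bounds X Y" "r < s"
    using cInf_lessD[OF GH_bounds_nonempty[OF XY]] less unfolding gromov_hausdorff_eq by blast
  then obtain Z :: "real metric" and X' Y' where Z: "X' \<subseteq> mspace Z" "Y' \<subseteq> mspace Z"
     "isometric_spaces X (submetric Z X')" "isometric_spaces Y (submetric Z Y')"
     "hausdorff_distance (mdist Z) X' Y' < s"
    unfolding GH_bounds_def by fastforce
  obtain t where t: "\<And>a. a \<in> X' \<Longrightarrow> \<exists>b\<in>Y'. mdist Z a b < t" "\<And>b. b \<in> Y' \<Longrightarrow> \<exists>a\<in>X'. mdist Z a b < t"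
    and "t < s"
    using cInf_lessD[OF GH_bounds_hausdorff[OF XY Z(1-4)] Z(5)[unfolded hausdorff_distance_def]]
    by blast
  obtain f where f: "f ` mspace X = X'"
      "\<And>x y. x \<in> mspace X \<Longrightarrow> y \<in> mspace X \<Longrightarrow> mdist Z (f x) (f y) = mdist X x y"
    using Z(1,3) unfolding isometric_spaces_def by (auto simp: Int_absorb2 bij_betw_def)
  obtain g where g: "g ` mspace Y = Y'"
      "\<And>x y. x \<in> mspace Y \<Longrightarrow> y \<in> mspace Y \<Longrightarrow> mdist Z (g x) (g y) = mdist Y x y"
    using Z(2,4) unfolding isometric_spaces_def by (auto simp: Int_absorb2 bij_betw_def)
  have "correspondence X Y {(x, y). x \<in> mspace X \<and> y \<in> mspace Y \<and> mdist Z (f x) (g y) < t} s"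
    (is "correspondence X Y ?R s")
    unfolding correspondence_def
  proof (intro conjI ballI allI impI)
    show "\<exists>y. (x, y) \<in> ?R" if "x \<in> mspace X" for x
      using t(1)[of "f x"] that f(1) g(1) by auto
    show "\<exists>x. (x, y) \<in> ?R" if "y \<in> mspace Y" for y
      using t(2)[of "g y"] that f(1) g(1) by auto
    fix x y x' y' assume xy: "(x, y) \<in> ?R" "(x', y') \<in> ?R"
    then have in_Z: "f x \<in> mspace Z" "f x' \<in> mspace Z" "g y \<in> mspace Z" "g y' \<in> mspace Z"
      using f(1) g(1) Z(1,2) by auto
    have "mdist Z (f x) (f x') \<le> mdist Z (f x) (g y) + mdist Z (g y) (g y') + mdist Z (f x') (g y')"
      using mdist_triangle[of "f x" Z "g y" "f x'"] mdist_triangle[of "g y" Z "g y'" "f x'"] in_Z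
      by (simp add: mdist_commute[of Z "g y'" "f x'"])
    moreover have "mdist Z (g y) (g y') \<le> mdist Z (f x) (g y) + mdist Z (f x) (f x') + mdist Z (f x') (g y')"
      using mdist_triangle[of "g y" Z "f x" "g y'"] mdist_triangle[of "f x" Z "f x'" "g y'"] in_Z
      by (simp add: mdist_commute[of Z "g y" "f x"])
    ultimately show "\<bar>mdist X x x' - mdist Y y y'\<bar> \<le> 2 * s"
      using f(2)[of x x'] g(2)[of y y'] xy \<open>t < s\<close> by auto
  qed auto
  then show thesis using that by blast
qed

lemma gromov_hausdorff_triangle:
  assumes X: "X \<in> compact_metrics" and Y: "Y \<in> compact_metrics" and W: "W \<in> compact_metrics"
  shows "gromov_hausdorff X W \<le> gromov_hausdorff X Y + gromov_hausdorff Y W"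
proof (rule field_le_epsilon)
  fix \<epsilon> :: real assume e: "\<epsilon> > 0"
  let ?s = "gromov_hausdorff X Y + \<epsilon> / 2" and ?t = "gromov_hausdorff Y W + \<epsilon> / 2"
  obtain R where R: "correspondence X Y R ?s"
    by (rule gromov_hausdorff_less[OF X Y, of ?s]) (use e in auto)
  obtain S where S: "correspondence Y W S ?t"
    by (rule gromov_hausdorff_less[OF Y W, of ?t]) (use e in auto)
  have "gromov_hausdorff X W \<le> ?s + ?t"
    using gromov_hausdorff_nonneg[OF X Y] gromov_hausdorff_nonneg[OF Y W] e
    by (intro gromov_hausdorff_le[OF X W correspondence_relcomp[OF R S]]) linarith
  then show "gromov_hausdorff X W \<le> gromov_hausdorff X Y + gromov_hausdorff Y W + \<epsilon>" by simp
qed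

lemma gromov_hausdorff_commute_le:
  assumes X: "X \<in> compact_metrics" and Y: "Y \<in> compact_metrics"
  shows "gromov_hausdorff X Y \<le> gromov_hausdorff Y X"
proof (rule field_le_epsilon)
  fix \<epsilon> :: real assume e: "\<epsilon> > 0"
  obtain R where R: "correspondence Y X R (gromov_hausdorff Y X + \<epsilon>)"
    by (rule gromov_hausdorff_less[OF Y X, of "gromov_hausdorff Y X + \<epsilon>"]) (use e in auto)
  show "gromov_hausdorff X Y \<le> gromov_hausdorff Y X + \<epsilon>"
    using gromov_hausdorff_nonneg[OF Y X] e
    by (intro gromov_hausdorff_le[OF X Y correspondence_converse[OF R]]) linarith
qed

text \<open>
  For a pair of maps \<open>f\<close>, \<open>g\<close> between \<open>X\<close> and \<open>Y\<close> the single identity \<open>d (f x) y = d x (g y)\<close>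
  says that they are mutually inverse isometries. Selections of a correspondence satisfy it up to
  its distortion, so Tychonoff's theorem provides an exact solution.
\<close>

lemma gromov_hausdorff_zero_imp_isometric:
  assumes X: "X \<in> compact_metrics" and Y: "Y \<in> compact_metrics" and zero: "gromov_hausdorff X Y = 0"
  shows "isometric_spaces X Y"
proof -
  define TX where "TX = product_topology (\<lambda>_. mtopology_of Y) (mspace X)"
  define TY where "TY = product_topology (\<lambda>_. mtopology_of X) (mspace Y)"
  define T where "T = prod_topology TX TY"
  have cX: "compact_space (mtopology_of X)" and cY: "compact_space (mtopology_of Y)"
    using X Y by (auto simp: compact_metrics_def)
  have T: "compact_space T"
    unfolding T_def TX_def TY_def
    by (simp add: compact_space_prod_topology compact_space_product_topology cX cY)
  \<comment> \<open>The condition at fixed \<open>x\<close> and \<open>y\<close> involves only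
    evaluations of the two maps. These are continuous in the product topology, so \<open>C n\<close>
    is closed although its members are arbitrary maps. The tolerance is twice the parameter of the
    correspondence used below.\<close>
  define C where "C n = (\<Inter>x\<in>mspace X. \<Inter>y\<in>mspace Y. {p \<in> topspace T.
    mdist Y (fst p x) y - mdist X x (snd p y) \<in> {- 2 / real (Suc n) .. 2 / real (Suc n)}})" for n
  have ne: "mspace X \<noteq> {}" "mspace Y \<noteq> {}" using X Y by (auto simp: compact_metrics_def)
  have clo: "closedin T (C n)" for n
    unfolding C_def
  proof (intro closedin_INT[OF ne(1)] closedin_INT[OF ne(2)] closedin_continuous_map_preimage)
    fix x y assume xy: "x \<in> mspace X" "y \<in> mspace Y"
    have f: "continuous_map T (mtopology_of Y) (\<lambda>p. fst p x)"
      using continuous_map_compose[OF continuous_map_fst continuous_map_product_projection[OF xy(1)],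
          of "\<lambda>_. mtopology_of Y" TY]
      unfolding T_def TX_def by (simp add: comp_def)
    have g: "continuous_map T (mtopology_of X) (\<lambda>p. snd p y)"
      using continuous_map_compose[OF continuous_map_snd continuous_map_product_projection[OF xy(2)],
          of TX "\<lambda>_. mtopology_of X"]
      unfolding T_def TY_def by (simp add: comp_def)
    show "continuous_map T euclideanreal (\<lambda>p. mdist Y (fst p x) y - mdist X x (snd p y))"
      using f g xy by (intro continuous_map_diff continuous_map_mdist) auto
  qed auto
  have "C n \<noteq> {}" for n
  proof -
    obtain R where R: "correspondence X Y R (1 / real (Suc n))"
      by (rule gromov_hausdorff_less[OF X Y, of "1 / real (Suc n)"]) (use zero in auto)
    then obtain f g where f: "\<And>x. x \<in> mspace X \<Longrightarrow> (x, f x) \<in> R"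
      and g: "\<And>y. y \<in> mspace Y \<Longrightarrow> (g y, y) \<in> R"
      using correspondenceD(3,4)[OF R] by metis
    have fg: "f x \<in> mspace Y" "g y \<in> mspace X" if "x \<in> mspace X" "y \<in> mspace Y" for x y
      using correspondenceD(1,2)[OF R] f[OF that(1)] g[OF that(2)] by auto
    have "mdist Y (f x) y - mdist X x (g y) \<in> {- 2 / real (Suc n) .. 2 / real (Suc n)}"
      if "x \<in> mspace X" "y \<in> mspace Y" for x y
      using correspondenceD(5)[OF R f[OF that(1)] g[OF that(2)]] by (simp add: abs_le_iff)
    \<comment> \<open>The points of a product topology are extensional functions, hence the
      restrictions.\<close>
    then have "(restrict f (mspace X), restrict g (mspace Y)) \<in> C n"
      using ne fg unfolding C_def T_def TX_def TY_def
      by auto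
    then show ?thesis by blast
  qed
  moreover have "decseq C"
  proof (rule decseq_SucI)
    fix n
    have "2 / real (Suc (Suc n)) \<le> 2 / real (Suc n)" by (intro divide_left_mono) auto
    then show "C (Suc n) \<subseteq> C n" unfolding C_def by fastforce
  qed
  ultimately have "(\<Inter>n. C n) \<noteq> {}" using compact_space_imp_nest[of T C, OF T clo] by blast
  then obtain f g where fg: "\<And>n. (f, g) \<in> C n" by auto
  have f: "f x \<in> mspace Y" if "x \<in> mspace X" for x
    using fg[of 0] that ne unfolding C_def T_def TX_def TY_def by auto
  have g: "g y \<in> mspace X" if "y \<in> mspace Y" for y
    using fg[of 0] that ne unfolding C_def T_def TX_def TY_def by auto
  have eq: "mdist Y (f x) y = mdist X x (g y)" if xy: "x \<in> mspace X" "y \<in> mspace Y" for x y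
  proof (rule ccontr)
    assume "mdist Y (f x) y \<noteq> mdist X x (g y)"
    then have "\<bar>mdist Y (f x) y - mdist X x (g y)\<bar> / 2 > 0" by simp
    then obtain n where "1 / real (Suc n) < \<bar>mdist Y (f x) y - mdist X x (g y)\<bar> / 2"
      using nat_approx_posE by blast
    moreover have "mdist Y (f x) y - mdist X x (g y) \<in> {- 2 / real (Suc n) .. 2 / real (Suc n)}"
      using fg[of n] xy unfolding C_def by auto
    then have "\<bar>mdist Y (f x) y - mdist X x (g y)\<bar> \<le> 2 / real (Suc n)"
      by (simp add: abs_le_iff)
    ultimately show False by simp
  qed
  \<comment> \<open>The choice \<open>y = f x\<close> in the identity makes its left side 0, the
    choice \<open>x = g y\<close> its right side.\<close>
  have gf: "g (f x) = x" if "x \<in> mspace X" for x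
  proof -
    have "mdist Y (f x) (f x) = 0" using f[OF that] by simp
    then have "mdist X x (g (f x)) = 0" using eq[OF that f[OF that]] by simp
    then show ?thesis using that f g by simp
  qed
  have fg': "f (g y) = y" if "y \<in> mspace Y" for y
  proof -
    have "mdist X (g y) (g y) = 0" using g[OF that] by simp
    then have "mdist Y (f (g y)) y = 0" using eq[OF g[OF that] that] by simp
    then show ?thesis using that f g by simp
  qed
  have "bij_betw f (mspace X) (mspace Y)"
    by (rule bij_betw_byWitness[of _ g]) (use f g gf fg' in auto)
  moreover have "mdist Y (f x) (f x') = mdist X x x'" if "x \<in> mspace X" "x' \<in> mspace X" for x x'
    using eq[OF that(1) f[OF that(2)]] gf[OF that(2)] by simp
  ultimately show ?thesis unfolding isometric_spaces_def by blast
qed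

lemma gromov_hausdorff_isometric:
  assumes "X \<in> compact_metrics" "Y \<in> compact_metrics" "isometric_spaces X Y"
  shows "gromov_hausdorff X Y = 0"
proof (rule antisym)
  obtain f where f: "bij_betw f (mspace X) (mspace Y)"
    "\<And>x y. x \<in> mspace X \<Longrightarrow> y \<in> mspace X \<Longrightarrow> mdist Y (f x) (f y) = mdist X x y"
    using assms(3) unfolding isometric_spaces_def by blast
  show "gromov_hausdorff X Y \<le> 0"
  proof (rule field_le_epsilon)
    fix \<epsilon> :: real assume "\<epsilon> > 0"
    \<comment> \<open>The graph of an isometry has distortion 0, but
      \<open>gromov_hausdorff_le\<close> requires a positive parameter.\<close>
    have "correspondence X Y {(x, f x) | x. x \<in> mspace X} \<epsilon>"
      unfolding correspondence_def using f \<open>\<epsilon> > 0\<close> by (auto simp: bij_betw_def)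
    then show "gromov_hausdorff X Y \<le> 0 + \<epsilon>"
      using gromov_hausdorff_le[OF assms(1,2)] \<open>\<epsilon> > 0\<close> by simp
  qed
qed (rule gromov_hausdorff_nonneg[OF assms(1,2)])

text \<open>
  The distance is cut off outside \<^const>\<open>GH_space\<close>, where \<^const>\<open>GH_dist\<close> need not be nonnegative.
\<close>

definition GH_metric :: "real metric set metric" where
  "GH_metric = metric (GH_space, \<lambda>A B. if A \<in> GH_space \<and> B \<in> GH_space then GH_dist A B else 0)"

lemma GH_space_rep:
  assumes "A \<in> GH_space"
  obtains X where "X \<in> A" "X \<in> compact_metrics"
  using assms unfolding GH_space_def by (auto simp: quotient_def intro: isometric_spaces_refl)

lemma GH_space_Metric_space:
  "Metric_space GH_space (\<lambda>A B. if A \<in> GH_space \<and> B \<in> GH_space then GH_dist A B else 0)"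
proof
  fix A B D
  let ?d = "\<lambda>A B. if A \<in> GH_space \<and> B \<in> GH_space then GH_dist A B else 0"
  show "0 \<le> ?d A B"
  proof (cases "A \<in> GH_space \<and> B \<in> GH_space")
    case True
    then obtain X Y where "X \<in> A" "X \<in> compact_metrics" "Y \<in> B" "Y \<in> compact_metrics"
      by (meson GH_space_rep)
    with True show ?thesis using gromov_hausdorff_nonneg by (simp add: GH_dist_eq)
  qed auto
  show "?d A B = ?d B A"
  proof (cases "A \<in> GH_space \<and> B \<in> GH_space")
    case True
    then obtain X Y where "X \<in> A" "X \<in> compact_metrics" "Y \<in> B" "Y \<in> compact_metrics"
      by (meson GH_space_rep)
    with True show ?thesis
      using gromov_hausdorff_commute_le by (simp add: GH_dist_eq antisym)
  qed auto
  assume AB: "A \<in> GH_space" "B \<in> GH_space"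
  then obtain X Y where X: "X \<in> A" "X \<in> compact_metrics" and Y: "Y \<in> B" "Y \<in> compact_metrics"
    by (meson GH_space_rep)
  have "A = B \<longleftrightarrow> isometric_spaces X Y"
    using quotient_eq_iff[OF equiv_isometric AB[unfolded GH_space_def] X(1) Y(1)] X Y by simp
  also have "\<dots> \<longleftrightarrow> gromov_hausdorff X Y = 0"
    using gromov_hausdorff_zero_imp_isometric gromov_hausdorff_isometric X(2) Y(2) by blast
  finally show "?d A B = 0 \<longleftrightarrow> A = B" using AB X Y by (simp add: GH_dist_eq)
  assume D: "D \<in> GH_space"
  then obtain W where "W \<in> D" "W \<in> compact_metrics" by (rule GH_space_rep)
  with AB D X Y show "?d A D \<le> ?d A B + ?d B D"
    using gromov_hausdorff_triangle by (simp add: GH_dist_eq)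
qed

lemma mspace_GH_metric [simp]: "mspace GH_metric = GH_space"
  unfolding GH_metric_def by (rule Metric_space.mspace_metric[OF GH_space_Metric_space])

lemma mdist_GH_metric: "A \<in> GH_space \<Longrightarrow> B \<in> GH_space \<Longrightarrow> mdist GH_metric A B = GH_dist A B"
  unfolding GH_metric_def by (simp add: Metric_space.mdist_metric[OF GH_space_Metric_space])

section \<open>An equilateral set with a centre\<close>

text \<open>
  A family of finite ultrametric spaces. The nonzero distances are \<open>4 m + \<epsilon> m\<close> for \<open>1 \<le> m \<le> n\<close>,
  far enough apart that perturbations by at most \<open>1\<close> cannot make two of them coincide.
\<close>

definition perturbed_dist :: "(real \<Rightarrow> real) \<Rightarrow> real \<Rightarrow> real \<Rightarrow> real" where
  "perturbed_dist \<epsilon> x y = (if x = y then 0 else \<bar>4 * max x y + \<epsilon> (max x y)\<bar>)"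

definition perturbed_space :: "nat \<Rightarrow> (real \<Rightarrow> real) \<Rightarrow> real metric" where
  "perturbed_space n \<epsilon> = metric (real ` {..n}, perturbed_dist \<epsilon>)"

text \<open>Two distinct naturals have maximum at least 1, so the term under the absolute value is
  at least \<open>4 - 1\<close>.\<close>

lemma perturbed_dist_pos:
  assumes "\<And>x. \<bar>\<epsilon> x\<bar> \<le> 1" "x \<noteq> y"
  shows "perturbed_dist \<epsilon> (real x) (real y) = 4 * real (max x y) + \<epsilon> (real (max x y))"
    and "perturbed_dist \<epsilon> (real x) (real y) \<ge> 3"
proof -
  have "real (max x y) \<ge> 1" using assms(2) by (auto simp: max_def)
  moreover have "- \<epsilon> (real (max x y)) \<le> 1" using assms(1)[of "real (max x y)"] by linarith
  ultimately have *: "4 * real (max x y) + \<epsilon> (real (max x y)) \<ge> 3" by linarith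
  show eq: "perturbed_dist \<epsilon> (real x) (real y) = 4 * real (max x y) + \<epsilon> (real (max x y))"
    using * assms(2) by (simp add: perturbed_dist_def of_nat_max)
  show "perturbed_dist \<epsilon> (real x) (real y) \<ge> 3" unfolding eq by (rule *)
qed

lemma perturbed_Metric_space:
  assumes e: "\<And>x. \<bar>\<epsilon> x\<bar> \<le> 1"
  shows "Metric_space (real ` {..n}) (perturbed_dist \<epsilon>)"
proof
  fix x y z
  \<comment> \<open>Nonnegativity is demanded for all reals, also off the carrier; the absolute
    value in the definition secures it.\<close>
  show "0 \<le> perturbed_dist \<epsilon> x y" by (simp add: perturbed_dist_def)
  show "perturbed_dist \<epsilon> x y = perturbed_dist \<epsilon> y x" by (simp add: perturbed_dist_def max.commute)
  assume "x \<in> real ` {..n}" "y \<in> real ` {..n}"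
  then obtain a b where ab: "x = real a" "y = real b" by blast
  then show "perturbed_dist \<epsilon> x y = 0 \<longleftrightarrow> x = y"
    using perturbed_dist_pos(2)[of \<epsilon> a b, OF e] by (cases "a = b") (auto simp: perturbed_dist_def)
  assume "z \<in> real ` {..n}"
  then obtain c where c: "z = real c" by blast
  show "perturbed_dist \<epsilon> x z \<le> perturbed_dist \<epsilon> x y + perturbed_dist \<epsilon> y z"
  proof (cases "a = b \<or> b = c \<or> a = c")
    case True
    then show ?thesis using ab c by (auto simp: perturbed_dist_def)
  next
    case False
    \<comment> \<open>A step of 4 outweighs a change of at most 2 in \<open>\<epsilon>\<close>.
      Distances therefore still increase with the maximum, and the perturbed space remains
      ultrametric.\<close>
    have mono: "4 * real k + \<epsilon> (real k) \<le> 4 * real m + \<epsilon> (real m)" if "k \<le> m" for k m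
      using that e[of "real k"] e[of "real m"] by (cases "k = m") (auto simp: abs_le_iff)
    have "perturbed_dist \<epsilon> x z \<le> perturbed_dist \<epsilon> x y \<or> perturbed_dist \<epsilon> x z \<le> perturbed_dist \<epsilon> y z"
      using mono[of "max a c" "max a b"] mono[of "max a c" "max b c"] False
        perturbed_dist_pos(1)[of \<epsilon>, OF e]
      unfolding ab c by (simp add: max_def split: if_splits)
    moreover have "perturbed_dist \<epsilon> x y \<ge> 0" "perturbed_dist \<epsilon> y z \<ge> 0"
      by (simp_all add: perturbed_dist_def)
    ultimately show ?thesis by linarith
  qed
qed

lemma perturbed_space_compact:
  assumes "\<And>x. \<bar>\<epsilon> x\<bar> \<le> 1"
  shows "perturbed_space n \<epsilon> \<in> compact_metrics"
    and "mspace (perturbed_space n \<epsilon>) = real ` {..n}"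
    and "mdist (perturbed_space n \<epsilon>) = perturbed_dist \<epsilon>"
proof -
  note M = perturbed_Metric_space[of \<epsilon> n, OF assms]
  show m: "mspace (perturbed_space n \<epsilon>) = real ` {..n}"
    unfolding perturbed_space_def by (rule Metric_space.mspace_metric[OF M])
  show "mdist (perturbed_space n \<epsilon>) = perturbed_dist \<epsilon>"
    unfolding perturbed_space_def by (rule Metric_space.mdist_metric[OF M])
  have "compactin (mtopology_of (perturbed_space n \<epsilon>)) (real ` {..n})"
    by (rule finite_imp_compactin) (simp_all add: m)
  then show "perturbed_space n \<epsilon> \<in> compact_metrics"
    by (simp add: compact_metrics_def compact_space_def m)
qed

text \<open>The identity correspondence changes each distance by at most 1, which is twice
  1/2.\<close>

lemma perturbed_space_le:
  assumes e: "\<And>x. \<bar>\<epsilon> x\<bar> \<le> 1"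
  shows "gromov_hausdorff (perturbed_space n (\<lambda>_. 0)) (perturbed_space n \<epsilon>) \<le> 1 / 2"
proof -
  have z: "\<bar>(\<lambda>_. 0) x\<bar> \<le> (1::real)" for x :: real by simp
  note P = perturbed_space_compact[of "\<lambda>_. 0", OF z] and E = perturbed_space_compact[of \<epsilon>, OF e]
  show ?thesis
  proof (rule gromov_hausdorff_le[OF P(1) E(1)])
    show "correspondence (perturbed_space n (\<lambda>_. 0)) (perturbed_space n \<epsilon>) (Id_on (real ` {..n})) (1 / 2)"
      unfolding correspondence_def
    proof (intro conjI ballI allI impI)
      fix x y x' y'
      assume "(x, y) \<in> Id_on (real ` {..n})" "(x', y') \<in> Id_on (real ` {..n})"
      then obtain a b where ab: "x = real a" "y = real a" "x' = real b" "y' = real b" by auto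
      have "\<bar>perturbed_dist (\<lambda>_. 0) (real a) (real b) - perturbed_dist \<epsilon> (real a) (real b)\<bar> \<le> 1"
      proof (cases "a = b")
        case False
        then show ?thesis
          using e[of "real (max a b)"] perturbed_dist_pos(1)[of \<epsilon>, OF e False]
            perturbed_dist_pos(1)[of "\<lambda>_. 0", OF z False] by simp
      qed (simp add: perturbed_dist_def)
      then show "\<bar>mdist (perturbed_space n (\<lambda>_. 0)) x x' - mdist (perturbed_space n \<epsilon>) y y'\<bar> \<le> 2 * (1 / 2)"
        unfolding ab P(3) E(3) by simp
    qed (auto simp: P E)
  qed simp
qed

definition bump :: "nat \<Rightarrow> real \<Rightarrow> real" where
  "bump j x = (if x = real j then 1 else - 1)"

lemma bump_bounded: "\<bar>bump j x\<bar> \<le> 1"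
  by (simp add: bump_def)

lemmas bump_space = perturbed_space_compact[of "bump j" for j, OF bump_bounded]

text \<open>The distance \<open>4 i + 1\<close> of the first space is at least \<open>2\<close> away from all distances of the second.\<close>

lemma bump_space_ge:
  assumes i: "1 \<le> i" "i \<le> n" and "i \<noteq> j"
  shows "1 \<le> gromov_hausdorff (perturbed_space n (bump i)) (perturbed_space n (bump j))"
proof (rule ccontr)
  let ?X = "perturbed_space n (bump i)" and ?Y = "perturbed_space n (bump j)"
  assume "\<not> 1 \<le> gromov_hausdorff ?X ?Y"
  then obtain s where s: "gromov_hausdorff ?X ?Y < s" "s < 1" using dense[of "gromov_hausdorff ?X ?Y" 1] by auto
  obtain R where R: "correspondence ?X ?Y R s"
    by (rule gromov_hausdorff_less[OF bump_space(1) bump_space(1) s(1)])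
  have "0 \<in> mspace ?X" "real i \<in> mspace ?X" using i by (auto simp: bump_space image_iff)
  then obtain y y' where y: "(0, y) \<in> R" "(real i, y') \<in> R" using correspondenceD(3)[OF R] by blast
  from correspondenceD(2)[OF R y(1)] correspondenceD(2)[OF R y(2)]
  obtain a b where ab: "y = real a" "y' = real b" unfolding bump_space by blast
  have "perturbed_dist (bump i) 0 (real i) = 4 * real i + 1"
    using perturbed_dist_pos(1)[of "bump i" 0 i, OF bump_bounded] i by (simp add: bump_def)
  then have d: "\<bar>4 * real i + 1 - perturbed_dist (bump j) (real a) (real b)\<bar> < 2"
    using correspondenceD(5)[OF R y] s(2) by (simp add: bump_space ab)
  show False
  proof (cases "a = b")
    case True
    then show False using d i by (simp add: perturbed_dist_def)
  next
    case False
    define m where "m = max a b"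
    have "\<bar>4 * real i + 1 - (4 * real m + bump j (real m))\<bar> < 2"
      using d perturbed_dist_pos(1)[of "bump j" a b, OF bump_bounded False] by (simp add: m_def)
    \<comment> \<open>For \<open>m = i\<close> the gap is \<open>1 - (- 1)\<close>, because
      \<open>i \<noteq> j\<close>. For \<open>m = i + 1\<close> it can be as small as
      \<open>4 - 2\<close>, so the spacing 4 is just enough. Below \<open>i\<close> it is at least
      4.\<close>
    moreover have "real i + 1 \<le> real m \<or> real m + 1 \<le> real i \<or> i = m" by linarith
    ultimately show False using \<open>i \<noteq> j\<close> by (auto simp: bump_def split: if_splits)
  qed
qed

section \<open>The configuration in the space of isometry classes\<close>

definition isometry_class :: "real metric \<Rightarrow> real metric set" where
  "isometry_class X =
     {(X, Y). X \<in> compact_metrics \<and> Y \<in> compact_metrics \<and> isometric_spaces X Y} `` {X}"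

lemma isometry_class_mem:
  assumes "X \<in> compact_metrics"
  shows "isometry_class X \<in> GH_space" "X \<in> isometry_class X"
proof -
  show "isometry_class X \<in> GH_space"
    unfolding isometry_class_def GH_space_def by (rule quotientI[OF assms])
  show "X \<in> isometry_class X"
    using assms isometric_spaces_refl by (simp add: isometry_class_def)
qed

lemma mdist_isometry_class:
  assumes "X \<in> compact_metrics" "Y \<in> compact_metrics"
  shows "mdist GH_metric (isometry_class X) (isometry_class Y) = gromov_hausdorff X Y"
  using isometry_class_mem[OF assms(1)] isometry_class_mem[OF assms(2)]
  by (simp add: mdist_GH_metric GH_dist_eq)

theorem corollary3p1:
  shows "steiner_ratio GH_space GH_dist = 1 / 2 \<and>
         steiner_gromov_ratio GH_space GH_dist = 1 / 2"
proof -
  let ?B = "\<lambda>n j. isometry_class (perturbed_space n (bump j))"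
  let ?M = "\<lambda>n. ?B n ` {1..n}" and ?c = "\<lambda>n. isometry_class (perturbed_space n (\<lambda>_. 0))"
  have zero: "perturbed_space n (\<lambda>_. 0) \<in> compact_metrics" for n
    by (rule perturbed_space_compact) simp
  have sep: "1 \<le> mdist GH_metric (?B n i) (?B n j)" if "i \<in> {1..n}" "i \<noteq> j" for n i j
    using that bump_space_ge by (simp add: mdist_isometry_class bump_space)
  \<comment> \<open>Coinciding classes would give fewer than \<open>n\<close> points; their distance
    0 contradicts \<open>sep\<close>.\<close>
  have inj: "inj_on (?B n) {1..n}" for n
  proof (rule inj_onI, rule ccontr)
    fix i j assume ij: "i \<in> {1..n}" "?B n i = ?B n j" "i \<noteq> j"
    have "?B n j \<in> mspace GH_metric" using isometry_class_mem(1)[OF bump_space(1)] by simp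
    then have "mdist GH_metric (?B n i) (?B n j) = 0" unfolding ij(2) by simp
    with sep[OF ij(1,3)] show False by simp
  qed
  have M: "finite (?M n)" "card (?M n) = n" "?M n \<subseteq> mspace GH_metric" "?c n \<in> mspace GH_metric" for n
    using isometry_class_mem(1)[OF bump_space(1)] isometry_class_mem(1)[OF zero] card_image[OF inj] by auto
  have star: "mdist GH_metric (?c n) x \<le> 1 / 2" if "x \<in> ?M n" for n x
    using that perturbed_space_le[OF bump_bounded]
    by (auto simp: mdist_isometry_class zero bump_space)
  have equilateral: "2 * (1 / 2) \<le> mdist GH_metric x y" if xy: "x \<in> ?M n" "y \<in> ?M n" "x \<noteq> y" for n x y
  proof -
    obtain i j where "i \<in> {1..n}" "x = ?B n i" "y = ?B n j" using xy(1,2) by blast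
    moreover from this have "i \<noteq> j" using xy(3) by auto
    ultimately show ?thesis using sep[of i n j] by simp
  qed
  \<comment> \<open>On the carrier the cut-off distance agrees with \<open>GH_dist\<close>, so the
    results for values of type \<open>metric\<close> apply.\<close>
  have "steiner_ratio GH_space GH_dist = steiner_ratio (mspace GH_metric) (mdist GH_metric)"
    "steiner_gromov_ratio GH_space GH_dist = steiner_gromov_ratio (mspace GH_metric) (mdist GH_metric)"
    unfolding mspace_GH_metric
    by (rule steiner_ratio_cong steiner_gromov_ratio_cong; simp add: mdist_GH_metric)+
  then show ?thesis
    using ratios_eq_half[of ?M GH_metric ?c "1 / 2", OF M(1-4) star equilateral] by simp
qed

end
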